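(* Let $M$ be a real $(2m+1)$-dimensional (pseudo-)Riemannian manifold with metric $g$, equipped with a real conformal Killing-Yano tensor $\phi$ with one-dimensional kernel $K$ and distinct non-zero eigenvalues $\pm\lambda_\mu$, $\mu=1,\dots,m$. Let $\{e^0,\theta^\mu,\theta_\mu\}_{\mu=1}^m$ be a (local, complex) coframe, with all members null except $e^0$, in which $\phi=\sum_\mu\lambda_\mu\,\theta^\mu\wedge\theta_\mu$, and let $\{V_0,V_\mu,V^\mu\}$ be the dual frame, so that $V_0$ spans $K$. Suppose that the $3$-form $\tau=d\phi$ satisfies $$\theta^\mu\wedge\tau(V^\mu,\cdot,\cdot)=0,\qquad \theta_\mu\wedge\tau(V_\mu,\cdot,\cdot)=0,$$ for each $\mu=1,\dots,m$ (no summation). Then each of the $2^m$ isotropic rank-$m$ distributions in $K^\perp$ spanned by one vector from each of the pairs $\{V_\mu,V^\mu\}$, $\mu=1,\dots,m$, is integrable. In Euclidean signature they define $2^m$ distinct (integrable) CR structures on $M$, whereas in Lorentzian signature they define just two geodesic congruences, each associated with $2^{m-1}$ of these integrable isotropic distributions.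
   Context: All statements are local. $\nabla$ is the Levi-Civita connection of $g$, and $X^*=g(X,\cdot)$. A conformal Killing-Yano tensor on an $n$-dimensional (pseudo-)Riemannian manifold is a $2$-form $\phi$ such that for all vector fields $X$ $$\nabla_X\phi=\tfrac13\,X\lrcorner\tau+\tfrac1{n-1}X^*\wedge \kappa$$ for some $3$-form $\tau$ and $1$-form $\kappa$; necessarily $\tau=d\phi$ and $\kappa=-d^*\phi$. Eigenvalues of $\phi$ are those of the endomorphism of $T_{\mathbb C}M$ obtained by raising one index with $g$; non-zero ones come in pairs $\pm\lambda_\mu$. The coframe satisfies $g=c\sum_\mu\theta^\mu\odot\theta_\mu+e^0\odot e^0$ for a normalisation constant $c$ ($\odot$ is the symmetric product); such a coframe exists locally under the hypothesis on the eigenvalues. The dual frame satisfies $e^0(V_0)=1$, $\theta^\mu(V_\nu)=\delta^\mu_\nu=\theta_\nu(V^\mu)$, with all other pairings zero. $\tau(V,\cdot,\cdot)$ denotes the $2$-form obtained by inserting $V$ in the first slot of $\tau$. $K^\perp$ is the orthogonal complement of $K$ in $T_{\mathbb C}M$. In Lorentzian signature the coframe is taken with one eigenvalue, say $\lambda_1$, and $\theta^1,\theta_1$ real, and the other eigenvalues imaginary with $\theta^\mu=\overline{\theta_\mu}$; the congruences in the claim are then the integral curves of the real null line fields $\mathcal D\cap\overline{\mathcal D}$. A complex distribution $\mathcal D\subset T_{\mathbb C}M$ is integrable if $[\mathcal D,\mathcal D]\subset\mathcal D$. An almost CR structure on a $(2m+1)$-dimensional manifold is a rank-$m$ subbundle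 $\mathcal D\subset T_{\mathbb C}M$ with $\mathcal D\cap\overline{\mathcal D}=0$; it is a CR structure if it is integrable. *)

theory Defs
  imports "HOL-Analysis.Analysis"
begin

text \<open>
  Everything is local, so \<open>M\<close> is the (open) domain of a chart in \<open>real^'n\<close>, and real tensor
  fields are given by their component arrays in the chart coordinates. The complexified tangent
  and cotangent spaces at a point are both \<open>complex^'n\<close>; subspaces, spans and dimensions in
  them are taken over \<open>complex\<close> (\<open>vec.subspace\<close>, \<open>vec.span\<close>, \<open>vec.dim\<close>).
\<close>


section \<open>Smooth maps\<close>

primrec ck_on ::
  "nat \<Rightarrow> 'a::real_normed_vector set \<Rightarrow> ('a \<Rightarrow> 'b::real_normed_vector) \<Rightarrow> bool" where
  "ck_on 0 U f = continuous_on U f"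
| "ck_on (Suc k) U f =
    ((\<forall>x\<in>U. f differentiable (at x)) \<and> (\<forall>v. ck_on k U (\<lambda>x. frechet_derivative f (at x) v)))"

definition smooth_on :: "'a::real_normed_vector set \<Rightarrow> ('a \<Rightarrow> 'b::real_normed_vector) \<Rightarrow> bool" where
  "smooth_on U f \<longleftrightarrow> (\<forall>k. ck_on k U f)"

definition pderiv_at :: "'n \<Rightarrow> (real^'n::finite \<Rightarrow> 'b::real_normed_vector) \<Rightarrow> real^'n \<Rightarrow> 'b" where
  "pderiv_at i f x = frechet_derivative f (at x) (axis i 1)"


section \<open>Pointwise multilinear algebra\<close>

definition cvec :: "real^'n \<Rightarrow> complex^'n" where
  "cvec v = (\<chi> i. complex_of_real (v $ i))"

definition cmat :: "real^'n^'m \<Rightarrow> complex^'n^'m" where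
  "cmat A = (\<chi> i. cvec (A $ i))"

definition cten :: "real^'n^'n^'n \<Rightarrow> complex^'n^'n^'n" where
  "cten T = (\<chi> i. cmat (T $ i))"

definition cnj_vec :: "complex^'n \<Rightarrow> complex^'n" where
  "cnj_vec v = (\<chi> i. cnj (v $ i))"

definition form1 :: "'a::comm_semiring_1^'n::finite \<Rightarrow> 'a^'n \<Rightarrow> 'a" where
  "form1 \<alpha> X = (\<Sum>i\<in>UNIV. \<alpha> $ i * X $ i)"

definition form2 :: "'a::comm_semiring_1^'n::finite^'n \<Rightarrow> 'a^'n \<Rightarrow> 'a^'n \<Rightarrow> 'a" where
  "form2 A X Y = (\<Sum>i\<in>UNIV. \<Sum>j\<in>UNIV. A $ i $ j * X $ i * Y $ j)"

definition form3 ::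
  "'a::comm_semiring_1^'n::finite^'n^'n \<Rightarrow> 'a^'n \<Rightarrow> 'a^'n \<Rightarrow> 'a^'n \<Rightarrow> 'a" where
  "form3 T X Y Z = (\<Sum>i\<in>UNIV. \<Sum>j\<in>UNIV. \<Sum>k\<in>UNIV. T $ i $ j $ k * X $ i * Y $ j * Z $ k)"

definition wedge11 ::
  "('a::comm_ring_1^'n::finite \<Rightarrow> 'a) \<Rightarrow> ('a^'n \<Rightarrow> 'a) \<Rightarrow> 'a^'n \<Rightarrow> 'a^'n \<Rightarrow> 'a" where
  "wedge11 \<alpha> \<beta> X Y = \<alpha> X * \<beta> Y - \<alpha> Y * \<beta> X"

text \<open>Wedge product of a 1-form with a 2-form; \<open>\<omega>\<close> is assumed alternating.\<close>

definition wedge12 ::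
  "('a::comm_ring_1^'n::finite \<Rightarrow> 'a) \<Rightarrow> ('a^'n \<Rightarrow> 'a^'n \<Rightarrow> 'a) \<Rightarrow> 'a^'n \<Rightarrow> 'a^'n \<Rightarrow> 'a^'n \<Rightarrow> 'a" where
  "wedge12 \<alpha> \<omega> X Y Z = \<alpha> X * \<omega> Y Z + \<alpha> Y * \<omega> Z X + \<alpha> Z * \<omega> X Y"

definition sym_prod ::
  "(complex^'n::finite \<Rightarrow> complex) \<Rightarrow> (complex^'n \<Rightarrow> complex) \<Rightarrow> complex^'n \<Rightarrow> complex^'n \<Rightarrow> complex" where
  "sym_prod \<alpha> \<beta> X Y = (\<alpha> X * \<beta> Y + \<alpha> Y * \<beta> X) / 2"


section \<open>Metrics and the Levi-Civita connection\<close>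

definition pseudo_riemannian_metric ::
  "(real^'n::finite) set \<Rightarrow> (real^'n \<Rightarrow> real^'n^'n) \<Rightarrow> bool" where
  "pseudo_riemannian_metric M g \<longleftrightarrow>
     smooth_on M g \<and> (\<forall>x\<in>M. transpose (g x) = g x \<and> invertible (g x))"

text \<open>\<open>g\<close> has exactly \<open>q\<close> negative directions: signature \<open>(n - q, q)\<close>.\<close>

definition has_index :: "(real^'n::finite) set \<Rightarrow> (real^'n \<Rightarrow> real^'n^'n) \<Rightarrow> nat \<Rightarrow> bool" where
  "has_index M g q \<longleftrightarrow>
     (\<forall>x\<in>M. \<exists>(P :: real^'n^'n) (\<epsilon> :: 'n \<Rightarrow> real). invertible P \<and> (\<forall>i. \<epsilon> i = 1 \<or> \<epsilon> i = -1) \<and> card {i. \<epsilon> i = -1} = q \<and>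
        transpose P ** g x ** P = (\<chi> i j. if i = j then \<epsilon> i else 0))"

definition euclidean_signature :: "(real^'n::finite) set \<Rightarrow> (real^'n \<Rightarrow> real^'n^'n) \<Rightarrow> bool" where
  "euclidean_signature M g \<longleftrightarrow> has_index M g 0"

definition lorentzian_signature :: "(real^'n::finite) set \<Rightarrow> (real^'n \<Rightarrow> real^'n^'n) \<Rightarrow> bool" where
  "lorentzian_signature M g \<longleftrightarrow> has_index M g 1"

text \<open>\<open>christoffel g x k i j\<close> is the symbol with upper index \<open>k\<close> and lower indices \<open>i\<close>, \<open>j\<close>.\<close>

definition christoffel ::
  "(real^'n::finite \<Rightarrow> real^'n^'n) \<Rightarrow> real^'n \<Rightarrow> 'n \<Rightarrow> 'n \<Rightarrow> 'n \<Rightarrow> real" where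
  "christoffel g x k i j =
     (\<Sum>l\<in>UNIV. matrix_inv (g x) $ k $ l *
        (pderiv_at i g x $ j $ l + pderiv_at j g x $ i $ l - pderiv_at l g x $ i $ j)) / 2"

text \<open>The first index of the result is the direction of differentiation.\<close>

definition nabla_form2 ::
  "(real^'n::finite \<Rightarrow> real^'n^'n) \<Rightarrow> (real^'n \<Rightarrow> real^'n^'n) \<Rightarrow> real^'n \<Rightarrow> real^'n^'n^'n" where
  "nabla_form2 g \<phi> x = (\<chi> k i j. pderiv_at k \<phi> x $ i $ j
     - (\<Sum>l\<in>UNIV. christoffel g x l k i * \<phi> x $ l $ j)
     - (\<Sum>l\<in>UNIV. christoffel g x l k j * \<phi> x $ i $ l))"

definition ext_deriv2 :: "(real^'n::finite \<Rightarrow> real^'n^'n) \<Rightarrow> real^'n \<Rightarrow> real^'n^'n^'n" where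
  "ext_deriv2 \<phi> x =
     (\<chi> i j k. pderiv_at i \<phi> x $ j $ k + pderiv_at j \<phi> x $ k $ i + pderiv_at k \<phi> x $ i $ j)"


section \<open>Conformal Killing-Yano tensors\<close>

definition two_form :: "(real^'n::finite) set \<Rightarrow> (real^'n \<Rightarrow> real^'n^'n) \<Rightarrow> bool" where
  "two_form M \<phi> \<longleftrightarrow> smooth_on M \<phi> \<and> (\<forall>x\<in>M. \<forall>i j. \<phi> x $ i $ j = - \<phi> x $ j $ i)"

definition three_form :: "(real^'n::finite) set \<Rightarrow> (real^'n \<Rightarrow> real^'n^'n^'n) \<Rightarrow> bool" where
  "three_form M \<tau> \<longleftrightarrow> smooth_on M \<tau> \<and>
     (\<forall>x\<in>M. \<forall>i j k. \<tau> x $ i $ j $ k = - \<tau> x $ j $ i $ k \<and> \<tau> x $ i $ j $ k = - \<tau> x $ i $ k $ j)"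

definition conformal_killing_yano ::
  "(real^'n::finite) set \<Rightarrow> (real^'n \<Rightarrow> real^'n^'n) \<Rightarrow> (real^'n \<Rightarrow> real^'n^'n) \<Rightarrow> bool" where
  "conformal_killing_yano M g \<phi> \<longleftrightarrow> two_form M \<phi> \<and>
     (\<exists>\<tau> \<kappa>. three_form M \<tau> \<and> smooth_on M \<kappa> \<and>
       (\<forall>x\<in>M. \<forall>X Y Z. form3 (nabla_form2 g \<phi> x) X Y Z =
          1 / 3 * form3 (\<tau> x) X Y Z +
          1 / (real CARD('n) - 1) * wedge11 (form2 (g x) X) (form1 (\<kappa> x)) Y Z))"

definition form2_kernel :: "(real^'n::finite \<Rightarrow> real^'n^'n) \<Rightarrow> real^'n \<Rightarrow> (complex^'n) set" where
  "form2_kernel \<phi> x = {X. \<forall>Y. form2 (cmat (\<phi> x)) X Y = 0}"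

definition form2_endo ::
  "(real^'n::finite \<Rightarrow> real^'n^'n) \<Rightarrow> (real^'n \<Rightarrow> real^'n^'n) \<Rightarrow> real^'n \<Rightarrow> complex^'n^'n" where
  "form2_endo g \<phi> x = cmat (matrix_inv (g x) ** \<phi> x)"

definition eigenvalues :: "complex^'n::finite^'n \<Rightarrow> complex set" where
  "eigenvalues A = {l. \<exists>v. v \<noteq> 0 \<and> A *v v = l *s v}"

definition distinct_eigenvalues ::
  "(real^'n::finite) set \<Rightarrow> (real^'n \<Rightarrow> real^'n^'n) \<Rightarrow> (real^'n \<Rightarrow> real^'n^'n) \<Rightarrow>
   ('m \<Rightarrow> real^'n \<Rightarrow> complex) \<Rightarrow> bool" where
  "distinct_eigenvalues M g \<phi> lam \<longleftrightarrow> (\<forall>x\<in>M.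
     eigenvalues (form2_endo g \<phi> x) - {0} = range (\<lambda>\<mu>. lam \<mu> x) \<union> range (\<lambda>\<mu>. - lam \<mu> x) \<and>
     (\<forall>\<mu>. lam \<mu> x \<noteq> 0) \<and>
     (\<forall>\<mu> \<nu>. \<mu> \<noteq> \<nu> \<longrightarrow> lam \<mu> x \<noteq> lam \<nu> x \<and> lam \<mu> x \<noteq> - lam \<nu> x))"


section \<open>Adapted frames\<close>

text \<open>
  \<open>\<theta>u \<mu>\<close> and \<open>\<theta>l \<mu>\<close> are the coframe members with upper and lower index, \<open>Vl \<mu>\<close> and
  \<open>Vu \<mu>\<close> the frame members with lower and upper index: \<open>Vl\<close> is dual to \<open>\<theta>u\<close>, and \<open>Vu\<close>
  to \<open>\<theta>l\<close>. With \<open>sym_prod\<close> normalised as above, \<open>form2 g (Vl \<mu>) (Vu \<mu>) = c / 2\<close>; that the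
  coefficients \<open>lam \<mu>\<close> of \<open>\<phi>\<close> are also its eigenvalues forces \<open>c\<close> to be \<open>2\<close> or \<open>-2\<close>.
\<close>

definition null_covector :: "real^'n::finite^'n \<Rightarrow> complex^'n \<Rightarrow> bool" where
  "null_covector G \<alpha> \<longleftrightarrow> form2 (cmat (matrix_inv G)) \<alpha> \<alpha> = 0"

definition adapted_coframe ::
  "(real^'n::finite) set \<Rightarrow> (real^'n \<Rightarrow> real^'n^'n) \<Rightarrow> (real^'n \<Rightarrow> real^'n^'n) \<Rightarrow>
   ('m::finite \<Rightarrow> real^'n \<Rightarrow> complex) \<Rightarrow> real \<Rightarrow> (real^'n \<Rightarrow> complex^'n) \<Rightarrow>
   ('m \<Rightarrow> real^'n \<Rightarrow> complex^'n) \<Rightarrow> ('m \<Rightarrow> real^'n \<Rightarrow> complex^'n) \<Rightarrow> bool" where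
  "adapted_coframe M g \<phi> lam c e0 \<theta>u \<theta>l \<longleftrightarrow>
     smooth_on M e0 \<and> (\<forall>\<mu>. smooth_on M (\<theta>u \<mu>) \<and> smooth_on M (\<theta>l \<mu>)) \<and>
     (\<forall>x\<in>M.
        vec.span (insert (e0 x) (range (\<lambda>\<mu>. \<theta>u \<mu> x) \<union> range (\<lambda>\<mu>. \<theta>l \<mu> x))) = UNIV \<and>
        \<not> null_covector (g x) (e0 x) \<and>
        (\<forall>\<mu>. null_covector (g x) (\<theta>u \<mu> x) \<and> null_covector (g x) (\<theta>l \<mu> x)) \<and>
        (\<forall>X Y. form2 (cmat (g x)) X Y =
           complex_of_real c * (\<Sum>\<mu>\<in>UNIV. sym_prod (form1 (\<theta>u \<mu> x)) (form1 (\<theta>l \<mu> x)) X Y) +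
           sym_prod (form1 (e0 x)) (form1 (e0 x)) X Y) \<and>
        (\<forall>X Y. form2 (cmat (\<phi> x)) X Y =
           (\<Sum>\<mu>\<in>UNIV. lam \<mu> x * wedge11 (form1 (\<theta>u \<mu> x)) (form1 (\<theta>l \<mu> x)) X Y)))"

definition dual_frame ::
  "(real^'n::finite) set \<Rightarrow>
   (real^'n \<Rightarrow> complex^'n) \<Rightarrow> ('m \<Rightarrow> real^'n \<Rightarrow> complex^'n) \<Rightarrow> ('m \<Rightarrow> real^'n \<Rightarrow> complex^'n) \<Rightarrow>
   (real^'n \<Rightarrow> complex^'n) \<Rightarrow> ('m \<Rightarrow> real^'n \<Rightarrow> complex^'n) \<Rightarrow> ('m \<Rightarrow> real^'n \<Rightarrow> complex^'n) \<Rightarrow> bool" where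
  "dual_frame M e0 \<theta>u \<theta>l V0 Vl Vu \<longleftrightarrow>
     smooth_on M V0 \<and> (\<forall>\<mu>. smooth_on M (Vl \<mu>) \<and> smooth_on M (Vu \<mu>)) \<and>
     (\<forall>x\<in>M.
        form1 (e0 x) (V0 x) = 1 \<and>
        (\<forall>\<mu>. form1 (e0 x) (Vl \<mu> x) = 0 \<and> form1 (e0 x) (Vu \<mu> x) = 0 \<and>
             form1 (\<theta>u \<mu> x) (V0 x) = 0 \<and> form1 (\<theta>l \<mu> x) (V0 x) = 0) \<and>
        (\<forall>\<mu> \<nu>. form1 (\<theta>u \<mu> x) (Vl \<nu> x) = (if \<mu> = \<nu> then 1 else 0) \<and>
               form1 (\<theta>l \<mu> x) (Vu \<nu> x) = (if \<mu> = \<nu> then 1 else 0) \<and>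
               form1 (\<theta>u \<mu> x) (Vu \<nu> x) = 0 \<and> form1 (\<theta>l \<mu> x) (Vl \<nu> x) = 0))"


section \<open>Complex distributions\<close>

type_synonym 'n distribution = "real^'n \<Rightarrow> (complex^'n) set"

definition smooth_distribution :: "(real^'n::finite) set \<Rightarrow> nat \<Rightarrow> 'n distribution \<Rightarrow> bool" where
  "smooth_distribution M k D \<longleftrightarrow>
     (\<forall>x\<in>M. vec.subspace (D x) \<and> vec.dim (D x) = k) \<and>
     (\<forall>x\<in>M. \<exists>W X. open W \<and> x \<in> W \<and> W \<subseteq> M \<and> (\<forall>i<k. smooth_on W (X i)) \<and>
        (\<forall>y\<in>W. D y = vec.span ((\<lambda>i. X i y) ` {..<k})))"

definition lie_bracket ::
  "(real^'n::finite \<Rightarrow> complex^'n) \<Rightarrow> (real^'n \<Rightarrow> complex^'n) \<Rightarrow> real^'n \<Rightarrow> complex^'n" where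
  "lie_bracket X Y x =
     (\<Sum>j\<in>UNIV. (X x $ j) *s pderiv_at j Y x) - (\<Sum>j\<in>UNIV. (Y x $ j) *s pderiv_at j X x)"

definition integrable_distribution :: "(real^'n::finite) set \<Rightarrow> 'n distribution \<Rightarrow> bool" where
  "integrable_distribution M D \<longleftrightarrow>
     (\<forall>W X Y. open W \<and> W \<subseteq> M \<and> smooth_on W X \<and> smooth_on W Y \<and> (\<forall>x\<in>W. X x \<in> D x \<and> Y x \<in> D x)
        \<longrightarrow> (\<forall>x\<in>W. lie_bracket X Y x \<in> D x))"

definition isotropic_distribution ::
  "(real^'n::finite) set \<Rightarrow> (real^'n \<Rightarrow> real^'n^'n) \<Rightarrow> 'n distribution \<Rightarrow> bool" where
  "isotropic_distribution M g D \<longleftrightarrow> (\<forall>x\<in>M. \<forall>X\<in>D x. \<forall>Y\<in>D x. form2 (cmat (g x)) X Y = 0)"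

definition orth_complement ::
  "(real^'n::finite \<Rightarrow> real^'n^'n) \<Rightarrow> 'n distribution \<Rightarrow> 'n distribution" where
  "orth_complement g K x = {X. \<forall>Y\<in>K x. form2 (cmat (g x)) X Y = 0}"

definition conj_distribution :: "'n::finite distribution \<Rightarrow> 'n distribution" where
  "conj_distribution D x = cnj_vec ` D x"

definition almost_CR_structure :: "(real^'n::finite) set \<Rightarrow> 'n distribution \<Rightarrow> bool" where
  "almost_CR_structure M D \<longleftrightarrow>
     (\<exists>m. CARD('n) = 2 * m + 1 \<and> smooth_distribution M m D) \<and>
     (\<forall>x\<in>M. D x \<inter> conj_distribution D x = {0})"

definition CR_structure :: "(real^'n::finite) set \<Rightarrow> 'n distribution \<Rightarrow> bool" where
  "CR_structure M D \<longleftrightarrow> almost_CR_structure M D \<and> integrable_distribution M D"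

text \<open>
  The distributions spanned by one vector out of each pair \<open>{Vl \<mu>, Vu \<mu>}\<close>. They are given a
  fixed value off \<open>M\<close>, so that they are equal as functions iff they agree on \<open>M\<close>.
\<close>

definition frame_distributions ::
  "(real^'n::finite) set \<Rightarrow> ('m \<Rightarrow> real^'n \<Rightarrow> complex^'n) \<Rightarrow> ('m \<Rightarrow> real^'n \<Rightarrow> complex^'n) \<Rightarrow>
   'n distribution set" where
  "frame_distributions M Vl Vu =
     range (\<lambda>s :: 'm \<Rightarrow> bool. \<lambda>x.
       if x \<in> M then vec.span (range (\<lambda>\<mu>. if s \<mu> then Vl \<mu> x else Vu \<mu> x)) else {})"


section \<open>Geodesic congruences\<close>

definition real_line_field :: "'n::finite distribution \<Rightarrow> real^'n \<Rightarrow> (real^'n) set" where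
  "real_line_field D x = {v. cvec v \<in> D x \<inter> conj_distribution D x}"

definition null_line_field ::
  "(real^'n::finite) set \<Rightarrow> (real^'n \<Rightarrow> real^'n^'n) \<Rightarrow> (real^'n \<Rightarrow> (real^'n) set) \<Rightarrow> bool" where
  "null_line_field M g L \<longleftrightarrow>
     (\<forall>x\<in>M. subspace (L x) \<and> dim (L x) = 1 \<and> (\<forall>v\<in>L x. form2 (g x) v v = 0))"

text \<open>Curves are pairs of an open parameter interval and a map, regular but with arbitrary
  parametrisation.\<close>

definition integral_curves ::
  "(real^'n::finite) set \<Rightarrow> (real^'n \<Rightarrow> (real^'n) set) \<Rightarrow> (real set \<times> (real \<Rightarrow> real^'n)) set" where
  "integral_curves M L = {(J, \<gamma>). open J \<and> is_interval J \<and> J \<noteq> {} \<and> smooth_on J \<gamma> \<and>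
     (\<forall>t\<in>J. \<gamma> t \<in> M \<and> vector_derivative \<gamma> (at t) \<noteq> 0 \<and> vector_derivative \<gamma> (at t) \<in> L (\<gamma> t))}"

definition acceleration ::
  "(real^'n::finite \<Rightarrow> real^'n^'n) \<Rightarrow> (real \<Rightarrow> real^'n) \<Rightarrow> real \<Rightarrow> real^'n" where
  "acceleration g \<gamma> t =
     vector_derivative (\<lambda>s. vector_derivative \<gamma> (at s)) (at t) +
     (\<chi> k. \<Sum>i\<in>UNIV. \<Sum>j\<in>UNIV. christoffel g (\<gamma> t) k i j *
        vector_derivative \<gamma> (at t) $ i * vector_derivative \<gamma> (at t) $ j)"

text \<open>Geodesics up to parametrisation: an affine parameter would make the acceleration vanish.\<close>

definition geodesic_on :: "(real^'n::finite \<Rightarrow> real^'n^'n) \<Rightarrow> real set \<Rightarrow> (real \<Rightarrow> real^'n) \<Rightarrow> bool" where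
  "geodesic_on g J \<gamma> \<longleftrightarrow>
     (\<exists>f. \<forall>t\<in>J. acceleration g \<gamma> t = f t *\<^sub>R vector_derivative \<gamma> (at t))"

definition geodesic_congruence ::
  "(real^'n::finite) set \<Rightarrow> (real^'n \<Rightarrow> real^'n^'n) \<Rightarrow> (real set \<times> (real \<Rightarrow> real^'n)) set \<Rightarrow> bool" where
  "geodesic_congruence M g C \<longleftrightarrow>
     (\<forall>x\<in>M. \<exists>(J, \<gamma>)\<in>C. x \<in> \<gamma> ` J) \<and> (\<forall>(J, \<gamma>)\<in>C. geodesic_on g J \<gamma>)"

text \<open>In Lorentzian signature one pair, here the one labelled \<open>\<mu>1\<close>, is real.\<close>

definition lorentzian_coframe ::
  "(real^'n::finite) set \<Rightarrow> ('m \<Rightarrow> real^'n \<Rightarrow> complex) \<Rightarrow>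
   ('m \<Rightarrow> real^'n \<Rightarrow> complex^'n) \<Rightarrow> ('m \<Rightarrow> real^'n \<Rightarrow> complex^'n) \<Rightarrow> 'm \<Rightarrow> bool" where
  "lorentzian_coframe M lam \<theta>u \<theta>l \<mu>1 \<longleftrightarrow> (\<forall>x\<in>M.
     lam \<mu>1 x \<in> \<real> \<and> cnj_vec (\<theta>u \<mu>1 x) = \<theta>u \<mu>1 x \<and> cnj_vec (\<theta>l \<mu>1 x) = \<theta>l \<mu>1 x \<and>
     (\<forall>\<mu>. \<mu> \<noteq> \<mu>1 \<longrightarrow> Re (lam \<mu> x) = 0 \<and> \<theta>u \<mu> x = cnj_vec (\<theta>l \<mu> x)))"

end

theory Submission
  imports Defs
begin

text \<open>
  Every frame vector \<open>V\<close> is an eigenvector of \<open>\<phi>\<close> relative to the metric: \<open>\<phi>(V, \<cdot>)\<close> is a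
  multiple of \<open>g(V, \<cdot>)\<close>, with factor proportional to \<open>\<lambda>\<^sub>\<mu>\<close>, \<open>-\<lambda>\<^sub>\<mu>\<close> or \<open>0\<close>. Let \<open>D\<close> be one of
  the distributions, \<open>A\<close>, \<open>B\<close>, \<open>X\<close> its frame vectors and \<open>a\<close>, \<open>b\<close> the eigenvalues of \<open>A\<close>,
  \<open>B\<close>. Both \<open>\<phi>(A, B)\<close> and \<open>g(A, B)\<close> vanish identically, and differentiating them along \<open>X\<close> gives
  \<open>(\<nabla>\<^sub>X\<phi>)(A, B) = (a + b) g(\<nabla>\<^sub>X A, B)\<close>. As \<open>g(X, A) = g(X, B) = 0\<close>, the conformal Killing-Yano
  equation reduces the left side to \<open>d\<phi>(X, A, B) / 3\<close>, which the hypothesis on \<open>d\<phi>\<close> kills because \<open>D\<close> never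
  contains both members of a pair. No two eigenvalues of frame vectors of \<open>D\<close> add up to zero, so
  \<open>g(\<nabla>\<^sub>X A, B) = 0\<close> (\<open>\<theta>_cov_deriv_V\<close>). The same computation with \<open>V\<^sub>0\<close> in the place of
  \<open>B\<close> works since \<open>a \<noteq> 0\<close> (\<open>\<theta>_cov_deriv_V0\<close>). The vectors orthogonal to \<open>D\<close> and to \<open>V\<^sub>0\<close> are those
  of \<open>D\<close>, so \<open>D\<close> is parallel along itself (\<open>\<D>_parallel\<close>).

  Integrability follows, as the connection is torsion-free. In Euclidean signature an isotropic
  space meets its conjugate in zero only, so \<open>D\<close> is a CR structure. In Lorentzian signature
  conjugation fixes both null vectors of one pair and interchanges the members of every other
  pair, so \<open>D\<close> meets its conjugate in the line spanned by the one real frame vector that it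
  contains, and \<open>\<D>_parallel\<close> applied to this vector says that its integral
  curves are geodesics. There are two such lines, and each belongs to half of the distributions.
  That integral curves pass through every point, and hence that the two congruences are distinct,
  is the local existence theorem for ordinary differential equations (\<open>integral_curve_exists\<close>).
\<close>


section \<open>Calculus of smooth maps\<close>

lemma ck_on_cong:
  assumes "open U" "\<And>x. x \<in> U \<Longrightarrow> f x = g x" "ck_on k U f"
  shows "ck_on k U g"
  using assms(2,3)
proof (induction k arbitrary: f g)
  case 0
  then show ?case by (metis ck_on.simps(1) continuous_on_cong)
next
  case (Suc k)
  have der: "(g has_derivative frechet_derivative f (at x)) (at x)" if "x \<in> U" for x
  proof (rule has_derivative_transform_within_open[OF _ \<open>open U\<close> that])
    show "(f has_derivative frechet_derivative f (at x)) (at x)"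
      using Suc.prems(2) that by (simp add: frechet_derivative_works)
  qed (use Suc.prems in auto)
  have eq: "frechet_derivative f (at x) = frechet_derivative g (at x)" if "x \<in> U" for x
    using frechet_derivative_at[OF der[OF that]] .
  show ?case
    unfolding ck_on.simps
  proof (intro conjI ballI allI)
    show "g differentiable at x" if "x \<in> U" for x
      using der[OF that] differentiable_def by blast
    show "ck_on k U (\<lambda>x. frechet_derivative g (at x) v)" for v
      by (rule Suc.IH[of "\<lambda>x. frechet_derivative f (at x) v"]) (use Suc.prems(2) eq in simp_all)
  qed
qed

lemma ck_on_SucI:
  assumes "open U" "\<And>x. x \<in> U \<Longrightarrow> (f has_derivative f' x) (at x)"
    and "\<And>v. ck_on k U (\<lambda>x. f' x v)"
  shows "ck_on (Suc k) U f"
proof -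
  have "f' x = frechet_derivative f (at x)" if "x \<in> U" for x
    using frechet_derivative_at[OF assms(2)[OF that]] .
  then have "ck_on k U (\<lambda>x. frechet_derivative f (at x) v)" for v
    by (intro ck_on_cong[OF \<open>open U\<close> _ assms(3)[of v]]) auto
  moreover have "\<forall>x\<in>U. f differentiable (at x)"
    using assms(2) differentiableI by blast
  ultimately show ?thesis by simp
qed

lemma ck_on_has_derivative:
  "ck_on (Suc k) U f \<Longrightarrow> x \<in> U \<Longrightarrow> (f has_derivative frechet_derivative f (at x)) (at x)"
  by (simp add: frechet_derivative_works)

lemma ck_on_Suc_imp: "ck_on (Suc k) U f \<Longrightarrow> ck_on k U f"
proof (induction k arbitrary: f)
  case 0
  then show ?case
    by (auto intro!: continuous_at_imp_continuous_on differentiable_imp_continuous_within)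
qed simp

lemma ck_on_const: "ck_on k U (\<lambda>x. c)"
  by (induction k arbitrary: c) (auto simp: frechet_derivative_const)

lemma ck_on_linear:
  assumes h: "bounded_linear h" and U: "open U" and "ck_on k U f"
  shows "ck_on k U (\<lambda>x. h (f x))"
  using assms(3)
proof (induction k arbitrary: f)
  case 0
  then show ?case using bounded_linear.continuous_on[OF h] by simp
next
  case (Suc k)
  show ?case
  proof (rule ck_on_SucI[OF U])
    show "((\<lambda>x. h (f x)) has_derivative (\<lambda>v. h (frechet_derivative f (at x) v))) (at x)"
      if "x \<in> U" for x
      by (rule bounded_linear.has_derivative[OF h ck_on_has_derivative[OF Suc.prems that]])
    show "ck_on k U (\<lambda>x. h (frechet_derivative f (at x) v))" for v
      by (rule Suc.IH) (use Suc.prems in simp)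
  qed
qed

lemma ck_on_add:
  assumes U: "open U" and "ck_on k U f" "ck_on k U g"
  shows "ck_on k U (\<lambda>x. f x + g x)"
  using assms(2,3)
proof (induction k arbitrary: f g)
  case 0
  then show ?case by (auto intro: continuous_intros)
next
  case (Suc k)
  show ?case
  proof (rule ck_on_SucI[OF U])
    show "((\<lambda>x. f x + g x) has_derivative
        (\<lambda>v. frechet_derivative f (at x) v + frechet_derivative g (at x) v)) (at x)"
      if "x \<in> U" for x
      by (rule has_derivative_add[OF ck_on_has_derivative[OF Suc.prems(1) that]
            ck_on_has_derivative[OF Suc.prems(2) that]])
    show "ck_on k U (\<lambda>x. frechet_derivative f (at x) v + frechet_derivative g (at x) v)" for v
      by (rule Suc.IH) (use Suc.prems in simp_all)
  qed
qed

lemma ck_on_sum: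
  assumes U: "open U" and "\<And>i. i \<in> I \<Longrightarrow> ck_on k U (f i)"
  shows "ck_on k U (\<lambda>x. \<Sum>i\<in>I. f i x)"
  using assms(2)
  by (induction I rule: infinite_finite_induct) (auto intro: ck_on_const ck_on_add[OF U])

lemma ck_on_bilinear:
  assumes h: "bounded_bilinear h" and U: "open U" and "ck_on k U f" "ck_on k U g"
  shows "ck_on k U (\<lambda>x. h (f x) (g x))"
  using assms(3,4)
proof (induction k arbitrary: f g)
  case 0
  then show ?case using bounded_bilinear.continuous_on[OF h] by simp
next
  case (Suc k)
  show ?case
  proof (rule ck_on_SucI[OF U])
    show "((\<lambda>x. h (f x) (g x)) has_derivative
        (\<lambda>v. h (f x) (frechet_derivative g (at x) v) + h (frechet_derivative f (at x) v) (g x))) (at x)"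
      if "x \<in> U" for x
      by (rule bounded_bilinear.FDERIV[OF h ck_on_has_derivative[OF Suc.prems(1) that]
            ck_on_has_derivative[OF Suc.prems(2) that]])
    show "ck_on k U (\<lambda>x. h (f x) (frechet_derivative g (at x) v) + h (frechet_derivative f (at x) v) (g x))"
      for v
    proof -
      have D: "ck_on k U f" "ck_on k U g" "ck_on k U (\<lambda>x. frechet_derivative f (at x) v)"
        "ck_on k U (\<lambda>x. frechet_derivative g (at x) v)"
        using Suc.prems ck_on_Suc_imp[OF Suc.prems(1)] ck_on_Suc_imp[OF Suc.prems(2)] by simp_all
      show ?thesis by (intro ck_on_add[OF U] Suc.IH D)
    qed
  qed
qed

text \<open>
  Expanding the chain rule in partial derivatives of \<open>F\<close> expresses the derivative by sums and
  products of maps of class \<open>k\<close>.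
\<close>

lemma ck_on_compose:
  fixes f :: "'a::real_normed_vector \<Rightarrow> real^'n::finite"
  assumes U: "open U" and sub: "f ` U \<subseteq> M" and "ck_on k M F" "ck_on k U f"
  shows "ck_on k U (\<lambda>x. F (f x))"
  using assms(3,4)
proof (induction k arbitrary: F)
  case 0
  then show ?case using sub continuous_on_compose2 by auto
next
  case (Suc k)
  have lin: "bounded_linear (frechet_derivative F (at y))" if "y \<in> M" for y
    using ck_on_has_derivative[OF Suc.prems(1) that] by (rule has_derivative_bounded_linear)
  show ?case
  proof (rule ck_on_SucI[OF U])
    fix x assume x: "x \<in> U"
    have der: "((\<lambda>x. F (f x)) has_derivative
        (\<lambda>v. frechet_derivative F (at (f x)) (frechet_derivative f (at x) v))) (at x)"
      by (rule has_derivative_compose[OF ck_on_has_derivative[OF Suc.prems(2) x]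
            ck_on_has_derivative[OF Suc.prems(1)]]) (use sub x in auto)
    have expand: "frechet_derivative F (at (f x)) w =
        (\<Sum>i\<in>UNIV. (w $ i) *\<^sub>R frechet_derivative F (at (f x)) (axis i 1))" for w
    proof -
      interpret L: bounded_linear "frechet_derivative F (at (f x))"
        by (rule lin) (use sub x in auto)
      have "w = (\<Sum>i\<in>UNIV. (w $ i) *\<^sub>R axis i 1)"
        using basis_expansion[of w] by (simp add: scalar_mult_eq_scaleR)
      then show ?thesis by (metis (no_types, lifting) L.scaleR L.sum sum.cong)
    qed
    show "((\<lambda>x. F (f x)) has_derivative (\<lambda>v. \<Sum>i\<in>UNIV.
        (frechet_derivative f (at x) v $ i) *\<^sub>R frechet_derivative F (at (f x)) (axis i 1))) (at x)"
      by (rule has_derivative_eq_rhs[OF der]) (intro ext expand)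
  next
    fix v
    show "ck_on k U (\<lambda>x. \<Sum>i\<in>UNIV.
        (frechet_derivative f (at x) v $ i) *\<^sub>R frechet_derivative F (at (f x)) (axis i 1))"
    proof (intro ck_on_sum[OF U] ck_on_bilinear[OF bounded_bilinear_scaleR U])
      fix i
      show "ck_on k U (\<lambda>x. frechet_derivative f (at x) v $ i)"
        by (rule ck_on_linear[OF bounded_linear_vec_nth U]) (use Suc.prems in simp)
      show "ck_on k U (\<lambda>x. frechet_derivative F (at (f x)) (axis i 1))"
        by (rule Suc.IH[OF _ ck_on_Suc_imp[OF Suc.prems(2)]]) (use Suc.prems in simp)
    qed
  qed
qed

lemma smooth_on_has_derivative:
  "smooth_on U f \<Longrightarrow> x \<in> U \<Longrightarrow> (f has_derivative frechet_derivative f (at x)) (at x)"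
  unfolding smooth_on_def by (rule ck_on_has_derivative[of 0]) auto

lemma smooth_on_differentiable: "smooth_on U f \<Longrightarrow> x \<in> U \<Longrightarrow> f differentiable (at x)"
  using smooth_on_has_derivative differentiable_def by blast

lemma smooth_on_linear:
  "bounded_linear h \<Longrightarrow> open U \<Longrightarrow> smooth_on U f \<Longrightarrow> smooth_on U (\<lambda>x. h (f x))"
  by (simp add: smooth_on_def ck_on_linear)


section \<open>Integral curves of a smooth vector field\<close>

text \<open>
  On a compact convex ball the partial derivatives are bounded, and the mean value inequality
  turns this bound into a Lipschitz constant.
\<close>

lemma smooth_on_lipschitz_cball:
  fixes V :: "real^'n::finite \<Rightarrow> 'b::real_normed_vector"
  assumes V: "smooth_on M V" and sub: "cball x0 r \<subseteq> M"
  obtains L where "L > 0"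
    "\<And>x y. x \<in> cball x0 r \<Longrightarrow> y \<in> cball x0 r \<Longrightarrow> norm (V x - V y) \<le> L * norm (x - y)"
proof -
  define D where "D i x = frechet_derivative V (at x) (axis i 1)" for i x
  have "\<exists>B. \<forall>x\<in>cball x0 r. norm (D i x) \<le> B" for i
  proof -
    have "ck_on (Suc 0) M V" using V by (simp add: smooth_on_def del: ck_on.simps)
    then have "continuous_on (cball x0 r) (D i)"
      using sub unfolding D_def by (auto intro: continuous_on_subset)
    then have "compact (D i ` cball x0 r)" by (intro compact_continuous_image) auto
    then show ?thesis using compact_imp_bounded bounded_iff by (metis imageI)
  qed
  then obtain B where B: "\<And>i x. x \<in> cball x0 r \<Longrightarrow> norm (D i x) \<le> B i" by metis
  define L where "L = (\<Sum>i\<in>UNIV. \<bar>B i\<bar>) + 1"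
  have "L > 0" unfolding L_def by (smt (verit) sum_nonneg)
  moreover have "norm (V x - V y) \<le> L * norm (x - y)"
    if "x \<in> cball x0 r" "y \<in> cball x0 r" for x y
  proof (rule differentiable_bound[OF convex_cball _ _ that])
    fix z assume z: "z \<in> cball x0 r"
    let ?V' = "frechet_derivative V (at z)"
    have der: "(V has_derivative ?V') (at z)"
      using smooth_on_has_derivative[OF V] sub z by auto
    then show "(V has_derivative ?V') (at z within cball x0 r)"
      by (rule has_derivative_at_withinI)
    interpret L: bounded_linear ?V' using der by (rule has_derivative_bounded_linear)
    show "onorm ?V' \<le> L"
    proof (rule onorm_le)
      fix w :: "real^'n"
      have "w = (\<Sum>i\<in>UNIV. (w $ i) *\<^sub>R axis i 1)"
        using basis_expansion[of w] by (simp add: scalar_mult_eq_scaleR)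
      then have "?V' w = (\<Sum>i\<in>UNIV. (w $ i) *\<^sub>R D i z)"
        unfolding D_def by (metis (no_types, lifting) L.scaleR L.sum sum.cong)
      also have "norm \<dots> \<le> (\<Sum>i\<in>UNIV. norm w * \<bar>B i\<bar>)"
      proof (rule sum_norm_le)
        fix i
        have "\<bar>w $ i\<bar> \<le> norm w" using component_le_norm_cart by blast
        moreover have "norm (D i z) \<le> \<bar>B i\<bar>" using B[OF z, of i] by linarith
        ultimately show "norm ((w $ i) *\<^sub>R D i z) \<le> norm w * \<bar>B i\<bar>"
          by (simp add: mult_mono)
      qed
      also have "\<dots> \<le> L * norm w"
        unfolding L_def by (simp add: sum_distrib_left[symmetric] algebra_simps)
      finally show "norm (?V' w) \<le> L * norm w" .
    qed
  qed
  ultimately show thesis using that by blast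
qed

text \<open>
  The Picard-Lindeloef theorem. The Picard operator acts on bounded continuous functions on the
  whole line with values in a ball, a complete space; times are clamped to \<open>[-a, a]\<close> so that only
  the integral over this interval matters. Smoothness of the solution bootstraps from
  \<open>\<gamma>' = V \<circ> \<gamma>\<close>.
\<close>

lemma integral_curve_exists:
  fixes V :: "real^'n::finite \<Rightarrow> real^'n"
  assumes M: "open M" and V: "smooth_on M V" and x0: "x0 \<in> M"
  obtains a \<gamma> where "a > 0" "\<gamma> 0 = x0" "smooth_on {-a<..<a} \<gamma>"
    "\<And>t. t \<in> {-a<..<a} \<Longrightarrow> \<gamma> t \<in> M \<and> (\<gamma> has_vector_derivative V (\<gamma> t)) (at t)"
proof -
  obtain r where r: "r > 0" and sub: "cball x0 r \<subseteq> M" using M x0 open_contains_cball by blast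
  obtain L where L: "L > 0"
    and lip: "\<And>x y. x \<in> cball x0 r \<Longrightarrow> y \<in> cball x0 r \<Longrightarrow> norm (V x - V y) \<le> L * norm (x - y)"
    using smooth_on_lipschitz_cball[OF V sub] by blast
  have contV: "continuous_on (cball x0 r) V"
    using V sub continuous_on_subset unfolding smooth_on_def by (metis ck_on.simps(1))
  define B where "B = norm (V x0) + L * r"
  have B: "norm (V x) \<le> B" if "x \<in> cball x0 r" for x
  proof -
    have "norm (V x - V x0) \<le> L * norm (x - x0)" using lip[OF that, of x0] r by simp
    also have "\<dots> \<le> L * r" using that L by (simp add: dist_norm norm_minus_commute)
    finally show ?thesis unfolding B_def using norm_triangle_sub[of "V x" "V x0"] by linarith
  qed
  have "B > 0" unfolding B_def using L r by (simp add: add_nonneg_pos)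
  \<comment> \<open>short enough for curves of speed \<open>B\<close> to stay in the ball and for the contraction factor \<open>1/2\<close>\<close>
  define a where "a = min (r / B) (1 / (2 * L))"
  have a: "a > 0" and aB: "a * B \<le> r" and aL: "a * L \<le> 1 / 2"
  proof -
    show "a > 0" unfolding a_def using r L \<open>B > 0\<close> by simp
    have "a \<le> r / B" "a \<le> 1 / (2 * L)" unfolding a_def by auto
    then show "a * B \<le> r" "a * L \<le> 1 / 2" using L \<open>B > 0\<close> by (simp_all add: field_simps)
  qed
  define S where "S = PiC (UNIV :: real set) (\<lambda>_. cball x0 r)"
  have inS: "apply_bcontfun f t \<in> cball x0 r" if "f \<in> S" for f t
    using that unfolding S_def mem_PiC_iff by auto
  define I where "I f t = integral {-a..t} (\<lambda>s. V (apply_bcontfun f s))" for f t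
  have contVf: "continuous_on A (\<lambda>s. V (apply_bcontfun f s))" if "f \<in> S" for f A
    by (rule continuous_on_compose2[OF contV]) (use inS[OF that] in auto)
  have I': "(I f has_vector_derivative V (apply_bcontfun f t)) (at t within {-a..a})"
    if "f \<in> S" "t \<in> {-a..a}" for f t
    unfolding I_def by (rule integral_has_vector_derivative[OF contVf[OF that(1)] that(2)])
  define p where "p t = max (-a) (min a t)" for t :: real
  have p: "p t \<in> {-a..a}" "\<bar>p t\<bar> \<le> a" for t unfolding p_def using a by auto
  have p_id: "p t = t" if "t \<in> {-a..a}" for t unfolding p_def using that by auto
  \<comment> \<open>integration starts at \<open>-a\<close>; subtracting \<open>I f 0\<close> moves the initial condition to time \<open>0\<close>\<close>
  define T where "T f t = x0 + (I f (p t) - I f 0)" for f t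
  have bound: "norm (I f t - I f 0) \<le> B * a" if f: "f \<in> S" and t: "t \<in> {-a..a}" for f t
  proof -
    have "norm (I f t - I f 0) \<le> B * norm (t - 0)"
    proof (rule differentiable_bound[OF convex_real_interval(5)])
      show "(I f has_derivative (\<lambda>h. h *\<^sub>R V (apply_bcontfun f s))) (at s within {-a..a})"
        if "s \<in> {-a..a}" for s using I'[OF f that] by (simp add: has_vector_derivative_def)
      show "onorm (\<lambda>h. h *\<^sub>R V (apply_bcontfun f s)) \<le> B" for s
        by (rule onorm_le) (simp add: mult.commute[of B] mult_left_mono[OF B[OF inS[OF f]]])
    qed (use t a in auto)
    also have "\<dots> \<le> B * a" using t \<open>B > 0\<close> by auto
    finally show ?thesis .
  qed
  have Tball: "T f t \<in> cball x0 r" if "f \<in> S" for f t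
    using bound[OF that p(1)[of t]] aB unfolding T_def
    by (simp add: dist_norm norm_minus_commute mult.commute)
  have Tcont: "T f \<in> bcontfun" if f: "f \<in> S" for f
  proof -
    have "continuous_on {-a..a} (I f)"
      unfolding continuous_on_eq_continuous_within
      by (intro ballI has_vector_derivative_continuous[OF I'[OF f]])
    then have "continuous_on UNIV (\<lambda>t. I f (p t))"
      by (rule continuous_on_compose2) (use p in \<open>auto simp: p_def intro!: continuous_intros\<close>)
    then have "continuous_on UNIV (T f)" unfolding T_def by (intro continuous_intros)
    moreover have "bounded (range (T f))"
      by (rule bounded_subset[OF bounded_cball[of x0 r]]) (use Tball[OF f] in auto)
    ultimately show ?thesis by (simp add: bcontfun_def)
  qed
  have app: "apply_bcontfun (Bcontfun (T f)) = T f" if "f \<in> S" for f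
    using Tcont[OF that] by (simp add: Bcontfun_inverse)
  have "\<exists>!f\<in>S. Bcontfun (T f) = f"
  proof (rule Banach_fix[where c = "1/2"])
    show "complete S" unfolding S_def complete_eq_closed by (intro closed_PiC) auto
    have "const_bcontfun x0 \<in> S" unfolding S_def mem_PiC_iff using r by auto
    then show "S \<noteq> {}" by auto
    show "(\<lambda>f. Bcontfun (T f)) ` S \<subseteq> S"
      using Tball app by (auto simp: S_def mem_PiC_iff)
    show "dist (Bcontfun (T f)) (Bcontfun (T g)) \<le> 1 / 2 * dist f g" if f: "f \<in> S" and g: "g \<in> S" for f g
    proof (rule dist_bound)
      fix t
      have "norm ((I f (p t) - I g (p t)) - (I f 0 - I g 0)) \<le> (L * dist f g) * norm (p t - 0)"
      proof (rule differentiable_bound[OF convex_real_interval(5)])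
        show "((\<lambda>t. I f t - I g t) has_derivative
            (\<lambda>h. h *\<^sub>R (V (apply_bcontfun f s) - V (apply_bcontfun g s)))) (at s within {-a..a})"
          if "s \<in> {-a..a}" for s
          using has_vector_derivative_diff[OF I'[OF f that] I'[OF g that]]
          by (simp add: has_vector_derivative_def)
        show "onorm (\<lambda>h. h *\<^sub>R (V (apply_bcontfun f s) - V (apply_bcontfun g s))) \<le> L * dist f g" for s
        proof (rule onorm_le)
          fix h :: real
          have "norm (V (apply_bcontfun f s) - V (apply_bcontfun g s)) \<le> L * norm (apply_bcontfun f s - apply_bcontfun g s)"
            by (rule lip[OF inS[OF f] inS[OF g]])
          also have "\<dots> \<le> L * dist f g"
            using L dist_bounded[of f s g] by (simp add: dist_norm)
          finally have "norm (V (apply_bcontfun f s) - V (apply_bcontfun g s)) \<le> L * dist f g" .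
          from mult_left_mono[OF this norm_ge_zero[of h]]
          show "norm (h *\<^sub>R (V (apply_bcontfun f s) - V (apply_bcontfun g s))) \<le> L * dist f g * norm h"
            by (simp add: ac_simps)
        qed
      qed (use p a in auto)
      also have "\<dots> \<le> (L * dist f g) * a" using p L by (intro mult_left_mono) auto
      also have "\<dots> \<le> 1 / 2 * dist f g"
        using mult_right_mono[OF aL, of "dist f g"] by (simp add: ac_simps)
      finally show "dist (apply_bcontfun (Bcontfun (T f)) t) (apply_bcontfun (Bcontfun (T g)) t) \<le> 1 / 2 * dist f g"
        unfolding app[OF f] app[OF g] T_def dist_norm by (simp add: algebra_simps)
    qed
  qed auto
  then obtain f where f: "f \<in> S" "Bcontfun (T f) = f" by blast
  define \<gamma> where "\<gamma> = apply_bcontfun f"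
  have \<gamma>: "\<gamma> t = T f t" for t unfolding \<gamma>_def using app[OF f(1)] f(2) by simp
  have "\<gamma> 0 = x0" unfolding \<gamma> T_def using p_id[of 0] a by simp
  moreover have sol: "\<gamma> t \<in> M \<and> (\<gamma> has_vector_derivative V (\<gamma> t)) (at t)" if t: "t \<in> {-a<..<a}" for t
  proof
    show "\<gamma> t \<in> M" using inS[OF f(1)] sub unfolding \<gamma>_def by blast
    have "(I f has_vector_derivative V (\<gamma> t)) (at t within {-a<..<a})"
      using I'[OF f(1), of t] t unfolding \<gamma>_def
      by (auto intro: has_vector_derivative_within_subset)
    then have "(I f has_vector_derivative V (\<gamma> t)) (at t)"
      using t at_within_open by (metis open_greaterThanLessThan)
    then have "((\<lambda>t. x0 + (I f t - I f 0)) has_vector_derivative V (\<gamma> t)) (at t)"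
      by (auto intro!: derivative_eq_intros)
    then show "(\<gamma> has_vector_derivative V (\<gamma> t)) (at t)"
      by (rule has_vector_derivative_transform_within_open[OF _ open_greaterThanLessThan t])
        (simp add: \<gamma> T_def p_id)
  qed
  moreover have "smooth_on {-a<..<a} \<gamma>"
    unfolding smooth_on_def
  proof
    fix k
    show "ck_on k {-a<..<a} \<gamma>"
    proof (induction k)
      case 0
      show ?case unfolding ck_on.simps
        by (intro continuous_at_imp_continuous_on ballI has_vector_derivative_continuous)
          (use sol in blast)
    next
      case (Suc k)
      show ?case
      proof (rule ck_on_SucI[OF open_greaterThanLessThan])
        show "(\<gamma> has_derivative (\<lambda>h. h *\<^sub>R V (\<gamma> t))) (at t)" if "t \<in> {-a<..<a}" for t
          using sol[OF that] by (simp add: has_vector_derivative_def)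
        have "ck_on k {-a<..<a} (\<lambda>t. V (\<gamma> t))"
          by (rule ck_on_compose[where M = M, OF open_greaterThanLessThan _ _ Suc.IH])
            (use sol V in \<open>auto simp: smooth_on_def\<close>)
        then show "ck_on k {-a<..<a} (\<lambda>t. v *\<^sub>R V (\<gamma> t))" for v
          by (rule ck_on_linear[OF bounded_linear_scaleR_right open_greaterThanLessThan])
      qed
    qed
  qed
  ultimately show thesis using that a by blast
qed


section \<open>Complex multilinear algebra\<close>

lemma form1_simps [simp]:
  "form1 \<alpha> (X + Y) = form1 \<alpha> X + form1 \<alpha> Y"
  "form1 \<alpha> (k *s X) = k * form1 \<alpha> X"
  "form1 \<alpha> 0 = 0"
  by (simp_all add: form1_def sum.distrib sum_distrib_left algebra_simps)

lemma form1_diff [simp]: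
  fixes \<alpha> :: "'a::comm_ring_1^'n::finite"
  shows "form1 \<alpha> (X - Y) = form1 \<alpha> X - form1 \<alpha> Y"
  by (simp add: form1_def sum_subtractf algebra_simps)

lemma form1_left_simps [simp]:
  "form1 (\<alpha> + \<beta>) X = form1 \<alpha> X + form1 \<beta> X"
  "form1 (k *s \<alpha>) X = k * form1 \<alpha> X"
  "form1 0 X = 0"
  by (simp_all add: form1_def sum.distrib sum_distrib_left algebra_simps)

lemma form1_sum [simp]: "form1 \<alpha> (\<Sum>i\<in>I. f i) = (\<Sum>i\<in>I. form1 \<alpha> (f i))"
  by (induction I rule: infinite_finite_induct) auto

lemma form2_left_simps [simp]:
  "form2 A (X + Y) Z = form2 A X Z + form2 A Y Z"
  "form2 A (k *s X) Z = k * form2 A X Z"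
  "form2 A 0 Z = 0"
  by (simp_all add: form2_def sum.distrib sum_distrib_left algebra_simps)

lemma form2_right_simps [simp]:
  "form2 A Z (X + Y) = form2 A Z X + form2 A Z Y"
  "form2 A Z (k *s X) = k * form2 A Z X"
  "form2 A Z 0 = 0"
  by (simp_all add: form2_def sum.distrib sum_distrib_left algebra_simps)

lemma form2_diff_right [simp]:
  fixes A :: "'a::comm_ring_1^'n::finite^'n"
  shows "form2 A Z (X - Y) = form2 A Z X - form2 A Z Y"
  by (simp add: form2_def sum_subtractf algebra_simps)

lemma form1_axis [simp]: "form1 \<alpha> (axis i 1) = \<alpha> $ i"
  by (simp add: form1_def axis_def if_distrib[of "(*) _"] sum.delta cong: if_cong)

lemma form2_axis_right: "form2 A X (axis j 1) = (\<Sum>i\<in>UNIV. A $ i $ j * X $ i)"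
  by (simp add: form2_def axis_def if_distrib[of "(*) _"] sum.delta cong: if_cong)

lemma form2_axis [simp]: "form2 A (axis i 1) (axis j 1) = A $ i $ j"
  unfolding form2_axis_right
  by (simp add: axis_def if_distrib[of "(*) _"] sum.delta cong: if_cong)

lemma form3_axis [simp]: "form3 T (axis i 1) (axis j 1) (axis k 1) = T $ i $ j $ k"
proof -
  have "form3 T (axis i 1) (axis j 1) (axis k 1)
      = (\<Sum>a\<in>UNIV. \<Sum>b\<in>UNIV. T $ a $ b $ k * axis i 1 $ a * axis j 1 $ b)"
    by (simp add: form3_def axis_def if_distrib[of "(*) _"] sum.delta cong: if_cong)
  also have "\<dots> = form2 (\<chi> a b. T $ a $ b $ k) (axis i 1) (axis j 1)"
    by (simp add: form2_def)
  finally show ?thesis by simp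
qed

lemma form2_transpose: "transpose A = A \<Longrightarrow> form2 A X Y = form2 A Y X"
  unfolding form2_def
  by (subst sum.swap) (simp add: transpose_def vec_eq_iff mult_ac)

lemma form2_cmat_sym: "transpose A = A \<Longrightarrow> form2 (cmat A) X Y = form2 (cmat A) Y X"
  by (rule form2_transpose) (simp add: transpose_def vec_eq_iff cmat_def cvec_def)

lemma form2_matrix: "form2 A X Y = (\<Sum>i\<in>UNIV. X $ i * (A *v Y) $ i)"
  by (simp add: form2_def matrix_vector_mult_def sum_distrib_left mult_ac)

lemma form2_cmat_nondegenerate:
  assumes "invertible A" and "\<And>X. form2 (cmat A) X Y = 0"
  shows "Y = 0"
proof -
  obtain B where B: "B ** A = mat 1" using assms(1) invertible_def by blast
  have AY: "cmat A *v Y = 0"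
  proof (rule vec_eq_iff[THEN iffD2], rule allI)
    fix i
    have "form2 (cmat A) (axis i 1) Y = (\<Sum>j\<in>UNIV. (if j = i then (cmat A *v Y) $ j else 0))"
      unfolding form2_matrix by (rule sum.cong) (auto simp: axis_def)
    then show "(cmat A *v Y) $ i = 0 $ i" using assms(2) by simp
  qed
  have "cmat B ** cmat A = mat 1"
  proof -
    have "(\<Sum>k\<in>UNIV. complex_of_real (B $ i $ k) * complex_of_real (A $ k $ j)) =
        complex_of_real ((B ** A) $ i $ j)" for i j
      by (simp add: matrix_matrix_mult_def)
    then show ?thesis unfolding B
      by (simp add: vec_eq_iff matrix_matrix_mult_def cmat_def cvec_def mat_def)
  qed
  then have "Y = cmat B *v (cmat A *v Y)" by (simp add: matrix_vector_mul_assoc)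
  then show ?thesis using AY by simp
qed

lemma cnj_vec_cnj_vec [simp]: "cnj_vec (cnj_vec X) = X"
  by (simp add: cnj_vec_def vec_eq_iff)

lemma cnj_vec_simps [simp]:
  "cnj_vec (X + Y) = cnj_vec X + cnj_vec Y" "cnj_vec (k *s X) = cnj k *s cnj_vec X"
  "cnj_vec 0 = 0" "cnj_vec (cvec v) = cvec v"
  by (simp_all add: cnj_vec_def cvec_def vec_eq_iff)

lemma form1_cnj: "form1 (cnj_vec \<alpha>) (cnj_vec X) = cnj (form1 \<alpha> X)"
  by (simp add: form1_def cnj_vec_def)

lemma form2_cnj: "form2 (cmat A) (cnj_vec X) (cnj_vec Y) = cnj (form2 (cmat A) X Y)"
  by (simp add: form2_def cnj_vec_def cmat_def cvec_def)

lemma form2_cvec: "form2 (cmat A) (cvec v) (cvec w) = complex_of_real (form2 A v w)"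
  by (simp add: form2_def cmat_def cvec_def)

lemma cvec_simps [simp]:
  "cvec (v + w) = cvec v + cvec w" "cvec (r *\<^sub>R v) = complex_of_real r *s cvec v" "cvec 0 = 0"
  by (simp_all add: cvec_def vec_eq_iff)

lemma of_real_smult: "complex_of_real r *s X = r *\<^sub>R X"
proof (rule vec_eq_iff[THEN iffD2], rule allI)
  show "(complex_of_real r *s X) $ i = (r *\<^sub>R X) $ i" for i
    by (simp add: scaleR_conv_of_real[of r "X $ i"])
qed

lemma cvec_eq_0_iff [simp]: "cvec v = 0 \<longleftrightarrow> v = 0"
  by (simp add: cvec_def vec_eq_iff)

lemma cvec_inj: "cvec v = cvec w \<Longrightarrow> v = w"
  by (simp add: cvec_def vec_eq_iff)

lemma real_vector_is_cvec: "cnj_vec X = X \<Longrightarrow> cvec (\<chi> i. Re (X $ i)) = X"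
  by (simp add: cnj_vec_def cvec_def vec_eq_iff complex_eq_iff)

text \<open>
  For \<open>X = a + i b\<close> the value is \<open>A(a, a) + A(b, b)\<close>, the mixed terms cancelling by symmetry.
\<close>

lemma form2_hermitian_definite:
  assumes sym: "transpose A = A" and pos: "\<And>v. v \<noteq> 0 \<Longrightarrow> form2 A v v > 0"
    and "form2 (cmat A) X (cnj_vec X) = 0"
  shows "X = 0"
proof -
  define a b where "a = (\<chi> i. Re (X $ i))" and "b = (\<chi> i. Im (X $ i))"
  have X: "X = cvec a + \<i> *s cvec b"
    by (simp add: a_def b_def vec_eq_iff cvec_def complex_eq_iff)
  have cX: "cnj_vec X = cvec a + (- \<i>) *s cvec b"
    unfolding X by simp
  have "0 = form2 (cmat A) X (cnj_vec X)" using assms(3) by simp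
  also have "\<dots> = complex_of_real (form2 A a a + form2 A b b)"
    unfolding cX unfolding X
    by (simp add: form2_cvec form2_transpose[OF sym, of b a] algebra_simps del: vector_smult_lneg)
  finally have "form2 A a a + form2 A b b = 0" by (metis of_real_eq_0_iff)
  moreover have "form2 A v v \<ge> 0" for v using pos[of v] by (cases "v = 0") auto
  ultimately have "a = 0" "b = 0" using pos by (smt (verit))+
  then show ?thesis unfolding X by simp
qed


section \<open>The Levi-Civita connection on complex vector fields\<close>

text \<open>
  The connection is extended complex-linearly. The direction is a single vector, not a field, since the
  derivative depends on its value at the point only.
\<close>

definition dir_deriv :: "complex^'n \<Rightarrow> (real^'n::finite \<Rightarrow> complex^'n) \<Rightarrow> real^'n \<Rightarrow> complex^'n" where
  "dir_deriv X Y x = (\<Sum>j\<in>UNIV. X $ j *s pderiv_at j Y x)"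

definition conn_term ::
  "(real^'n::finite \<Rightarrow> real^'n^'n) \<Rightarrow> real^'n \<Rightarrow> complex^'n \<Rightarrow> complex^'n \<Rightarrow> complex^'n" where
  "conn_term g x X Y =
     (\<chi> k. \<Sum>i\<in>UNIV. \<Sum>j\<in>UNIV. complex_of_real (christoffel g x k i j) * X $ i * Y $ j)"

definition cov_deriv ::
  "(real^'n::finite \<Rightarrow> real^'n^'n) \<Rightarrow> complex^'n \<Rightarrow> (real^'n \<Rightarrow> complex^'n) \<Rightarrow> real^'n \<Rightarrow> complex^'n" where
  "cov_deriv g X Y x = dir_deriv X Y x + conn_term g x X (Y x)"

lemma cov_deriv_simps [simp]:
  "cov_deriv g (X + X') Y x = cov_deriv g X Y x + cov_deriv g X' Y x"
  "cov_deriv g (k *s X) Y x = k *s cov_deriv g X Y x"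
  "cov_deriv g 0 Y x = 0"
  by (simp_all add: cov_deriv_def dir_deriv_def conn_term_def vec_eq_iff sum.distrib
      sum_distrib_left algebra_simps)

lemma dir_deriv_cvec:
  assumes "Y differentiable (at x)"
  shows "dir_deriv (cvec v) Y x = frechet_derivative Y (at x) v"
proof -
  interpret L: bounded_linear "frechet_derivative Y (at x)"
    using assms frechet_derivative_works has_derivative_bounded_linear by blast
  have "v = (\<Sum>i\<in>UNIV. (v $ i) *\<^sub>R axis i 1)"
    using basis_expansion[of v] by (simp add: scalar_mult_eq_scaleR)
  then have "frechet_derivative Y (at x) v = (\<Sum>i\<in>UNIV. (v $ i) *\<^sub>R frechet_derivative Y (at x) (axis i 1))"
    by (metis (no_types, lifting) L.scaleR L.sum sum.cong)
  then show ?thesis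
    by (simp add: dir_deriv_def pderiv_at_def cvec_def of_real_smult)
qed

lemma pderiv_at_has_derivative: "(f has_derivative f') (at x) \<Longrightarrow> pderiv_at i f x = f' (axis i 1)"
  unfolding pderiv_at_def using frechet_derivative_at by metis

lemma has_derivative_nth:
  "(f has_derivative f') F \<Longrightarrow> ((\<lambda>x. f x $ i) has_derivative (\<lambda>h. f' h $ i)) F"
  by (rule bounded_linear.has_derivative[OF bounded_linear_vec_nth])

lemma pderiv_at_nth:
  assumes "f differentiable (at x)"
  shows "pderiv_at k (\<lambda>y. f y $ i) x = pderiv_at k f x $ i"
  using pderiv_at_has_derivative[OF has_derivative_nth] pderiv_at_has_derivative assms
  unfolding differentiable_def by metis

lemma pderiv_at_cong:
  assumes "open W" "x \<in> W" "\<And>y. y \<in> W \<Longrightarrow> f y = h y" "f differentiable (at x)"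
  shows "pderiv_at k f x = pderiv_at k h x"
proof -
  have "(f has_derivative frechet_derivative f (at x)) (at x)"
    using assms(4) by (simp add: frechet_derivative_works)
  then have "(h has_derivative frechet_derivative f (at x)) (at x)"
    by (rule has_derivative_transform_within_open[OF _ assms(1,2)]) (use assms(3) in auto)
  then show ?thesis using pderiv_at_has_derivative pderiv_at_def by metis
qed

lemma pderiv_at_form2:
  assumes A: "A differentiable (at x)" and Y: "Y differentiable (at x)"
    and Z: "Z differentiable (at x)"
  shows "(\<lambda>y. form2 (cmat (A y)) (Y y) (Z y)) differentiable (at x)" (is "?f differentiable _")
    and "pderiv_at k (\<lambda>y. form2 (cmat (A y)) (Y y) (Z y)) x =
      form2 (cmat (pderiv_at k A x)) (Y x) (Z x) + form2 (cmat (A x)) (pderiv_at k Y x) (Z x)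
      + form2 (cmat (A x)) (Y x) (pderiv_at k Z x)"
proof -
  obtain A' Y' Z' where A': "(A has_derivative A') (at x)" and Y': "(Y has_derivative Y') (at x)"
    and Z': "(Z has_derivative Z') (at x)"
    using assms unfolding differentiable_def by blast
  have comp: "((\<lambda>y. complex_of_real (A y $ i $ j)) has_derivative (\<lambda>h. complex_of_real (A' h $ i $ j))) (at x)"
    for i j
    by (intro has_derivative_of_real has_derivative_nth A')
  have "((\<lambda>y. complex_of_real (A y $ i $ j) * Y y $ i * Z y $ j) has_derivative
     (\<lambda>h. complex_of_real (A' h $ i $ j) * Y x $ i * Z x $ j
       + complex_of_real (A x $ i $ j) * Y' h $ i * Z x $ j
       + complex_of_real (A x $ i $ j) * Y x $ i * Z' h $ j)) (at x)" for i j
    by (rule has_derivative_eq_rhs[OF has_derivative_mult[OF has_derivative_mult[OF comp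
              has_derivative_nth[OF Y']] has_derivative_nth[OF Z']]])
      (simp add: fun_eq_iff algebra_simps)
  then have der: "(?f has_derivative (\<lambda>h. form2 (cmat (A' h)) (Y x) (Z x)
      + form2 (cmat (A x)) (Y' h) (Z x) + form2 (cmat (A x)) (Y x) (Z' h))) (at x)"
    unfolding form2_def cmat_def cvec_def sum.distrib[symmetric]
    by (intro has_derivative_sum) simp
  then show "?f differentiable (at x)" by (rule differentiableI)
  show "pderiv_at k ?f x =
      form2 (cmat (pderiv_at k A x)) (Y x) (Z x) + form2 (cmat (A x)) (pderiv_at k Y x) (Z x)
      + form2 (cmat (A x)) (Y x) (pderiv_at k Z x)"
    unfolding pderiv_at_has_derivative[OF der] pderiv_at_has_derivative[OF A']
      pderiv_at_has_derivative[OF Y'] pderiv_at_has_derivative[OF Z'] ..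
qed

lemma form2_sum_left: "form2 A (\<Sum>i\<in>I. f i) Z = (\<Sum>i\<in>I. form2 A (f i) Z)"
  by (induction I rule: infinite_finite_induct) auto

lemma form2_sum_right: "form2 A Z (\<Sum>i\<in>I. f i) = (\<Sum>i\<in>I. form2 A Z (f i))"
  by (induction I rule: infinite_finite_induct) auto

lemma form3_cten_nabla:
  "form3 (cten (nabla_form2 g A x)) X Y Z =
    (\<Sum>k\<in>UNIV. X $ k * form2 (cmat (pderiv_at k A x)) Y Z)
    - form2 (cmat (A x)) (conn_term g x X Y) Z - form2 (cmat (A x)) Y (conn_term g x X Z)"
proof -
  let ?G = "\<lambda>k i j. complex_of_real (christoffel g x k i j)"
  let ?A = "\<lambda>i j. complex_of_real (A x $ i $ j)"
  have 1: "form2 (cmat (A x)) (conn_term g x X Y) Z =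
      (\<Sum>k\<in>UNIV. \<Sum>i\<in>UNIV. \<Sum>j\<in>UNIV. (\<Sum>l\<in>UNIV. ?G l k i * ?A l j) * X $ k * Y $ i * Z $ j)"
  proof -
    have "form2 (cmat (A x)) (conn_term g x X Y) Z =
      (\<Sum>l\<in>UNIV. \<Sum>j\<in>UNIV. \<Sum>k\<in>UNIV. \<Sum>i\<in>UNIV. ?G l k i * ?A l j * X $ k * Y $ i * Z $ j)"
      by (simp add: form2_def conn_term_def cmat_def cvec_def sum_distrib_left sum_distrib_right mult_ac)
    also have "\<dots> = (\<Sum>j\<in>UNIV. \<Sum>k\<in>UNIV. \<Sum>i\<in>UNIV. \<Sum>l\<in>UNIV. ?G l k i * ?A l j * X $ k * Y $ i * Z $ j)"
      by (subst sum.swap, rule sum.cong[OF refl], subst sum.swap, rule sum.cong[OF refl], rule sum.swap)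
    also have "\<dots> = (\<Sum>k\<in>UNIV. \<Sum>i\<in>UNIV. \<Sum>j\<in>UNIV. \<Sum>l\<in>UNIV. ?G l k i * ?A l j * X $ k * Y $ i * Z $ j)"
      by (subst sum.swap, rule sum.cong[OF refl], rule sum.swap)
    finally show ?thesis by (simp add: sum_distrib_right)
  qed
  have 2: "form2 (cmat (A x)) Y (conn_term g x X Z) =
      (\<Sum>k\<in>UNIV. \<Sum>i\<in>UNIV. \<Sum>j\<in>UNIV. (\<Sum>l\<in>UNIV. ?G l k j * ?A i l) * X $ k * Y $ i * Z $ j)"
  proof -
    have "form2 (cmat (A x)) Y (conn_term g x X Z) =
      (\<Sum>i\<in>UNIV. \<Sum>l\<in>UNIV. \<Sum>k\<in>UNIV. \<Sum>j\<in>UNIV. ?G l k j * ?A i l * X $ k * Y $ i * Z $ j)"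
      by (simp add: form2_def conn_term_def cmat_def cvec_def sum_distrib_left sum_distrib_right mult_ac)
    also have "\<dots> = (\<Sum>i\<in>UNIV. \<Sum>k\<in>UNIV. \<Sum>j\<in>UNIV. \<Sum>l\<in>UNIV. ?G l k j * ?A i l * X $ k * Y $ i * Z $ j)"
      by (rule sum.cong[OF refl], subst sum.swap, rule sum.cong[OF refl], rule sum.swap)
    also have "\<dots> = (\<Sum>k\<in>UNIV. \<Sum>i\<in>UNIV. \<Sum>j\<in>UNIV. \<Sum>l\<in>UNIV. ?G l k j * ?A i l * X $ k * Y $ i * Z $ j)"
      by (rule sum.swap)
    finally show ?thesis by (simp add: sum_distrib_right)
  qed
  have 3: "(\<Sum>k\<in>UNIV. X $ k * form2 (cmat (pderiv_at k A x)) Y Z) =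
      (\<Sum>k\<in>UNIV. \<Sum>i\<in>UNIV. \<Sum>j\<in>UNIV. complex_of_real (pderiv_at k A x $ i $ j) * X $ k * Y $ i * Z $ j)"
    by (simp add: form2_def cmat_def cvec_def sum_distrib_left mult_ac)
  show ?thesis
    unfolding 1 2 3 sum_subtractf[symmetric]
    by (simp add: form3_def cten_def cmat_def cvec_def nabla_form2_def algebra_simps)
qed

text \<open>
  The symmetry of \<open>A\<close> is left open, so that the rule serves both the metric and the 2-form.
\<close>

lemma cov_deriv_leibniz:
  assumes "A differentiable (at x)" "Y differentiable (at x)" "Z differentiable (at x)"
  shows "(\<Sum>k\<in>UNIV. X $ k * pderiv_at k (\<lambda>y. form2 (cmat (A y)) (Y y) (Z y)) x) =
    form3 (cten (nabla_form2 g A x)) X (Y x) (Z x)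
    + form2 (cmat (A x)) (cov_deriv g X Y x) (Z x) + form2 (cmat (A x)) (Y x) (cov_deriv g X Z x)"
  unfolding pderiv_at_form2(2)[OF assms] form3_cten_nabla cov_deriv_def dir_deriv_def
  by (simp add: form2_sum_left form2_sum_right sum.distrib algebra_simps)

lemma cov_deriv_leibniz_zero:
  assumes "A differentiable (at x)" "Y differentiable (at x)" "Z differentiable (at x)"
    and W: "open W" "x \<in> W" and const: "\<And>y. y \<in> W \<Longrightarrow> form2 (cmat (A y)) (Y y) (Z y) = 0"
  shows "form3 (cten (nabla_form2 g A x)) X (Y x) (Z x)
    + form2 (cmat (A x)) (cov_deriv g X Y x) (Z x) + form2 (cmat (A x)) (Y x) (cov_deriv g X Z x) = 0"
proof -
  have "pderiv_at k (\<lambda>y. form2 (cmat (A y)) (Y y) (Z y)) x = 0" for k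
    using pderiv_at_cong[OF W const pderiv_at_form2(1)[OF assms(1-3)]]
      pderiv_at_has_derivative[OF has_derivative_const] by metis
  then show ?thesis using cov_deriv_leibniz[OF assms(1-3), of X g] by simp
qed

locale metric_chart =
  fixes M :: "(real^'n::finite) set" and g :: "real^'n \<Rightarrow> real^'n^'n"
  assumes open_M: "open M" and metric: "pseudo_riemannian_metric M g"
begin

lemma g_sym: "x \<in> M \<Longrightarrow> transpose (g x) = g x" and g_inv: "x \<in> M \<Longrightarrow> invertible (g x)"
  and g_smooth: "smooth_on M g"
  using metric by (auto simp: pseudo_riemannian_metric_def)

lemma g_differentiable: "x \<in> M \<Longrightarrow> g differentiable (at x)"
  using g_smooth by (rule smooth_on_differentiable)

lemma g_nth_sym: "x \<in> M \<Longrightarrow> g x $ i $ j = g x $ j $ i"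
  using g_sym[of x] by (metis transpose_def vec_lambda_beta)

lemma pderiv_at_g_sym:
  assumes x: "x \<in> M"
  shows "pderiv_at k g x $ i $ j = pderiv_at k g x $ j $ i"
proof -
  have d: "(\<lambda>y. g y $ i) differentiable (at x)" for i
    using g_differentiable[OF x] has_derivative_nth unfolding differentiable_def by blast
  then have d2: "(\<lambda>y. g y $ i $ j) differentiable (at x)" for i j
    using has_derivative_nth unfolding differentiable_def by blast
  have "pderiv_at k g x $ i $ j = pderiv_at k (\<lambda>y. g y $ i $ j) x" for i j
    using pderiv_at_nth[OF d] pderiv_at_nth[OF g_differentiable[OF x]] by metis
  then show ?thesis
    using pderiv_at_cong[OF open_M x _ d2, of i j "\<lambda>y. g y $ j $ i"] g_nth_sym by metis
qed

lemma christoffel_sym: "x \<in> M \<Longrightarrow> christoffel g x k i j = christoffel g x k j i"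
  unfolding christoffel_def using pderiv_at_g_sym by (simp add: add.commute)

lemma christoffel_lower:
  assumes x: "x \<in> M"
  shows "(\<Sum>l\<in>UNIV. christoffel g x l k i * g x $ l $ j) =
    (pderiv_at k g x $ i $ j + pderiv_at i g x $ k $ j - pderiv_at j g x $ k $ i) / 2"
proof -
  define P where "P m = pderiv_at k g x $ i $ m + pderiv_at i g x $ k $ m - pderiv_at m g x $ k $ i" for m
  have "g x ** matrix_inv (g x) = mat 1" 
    using someI_ex[OF g_inv[OF x, unfolded invertible_def]] by (simp add: matrix_inv_def)
  then have delta: "(\<Sum>l\<in>UNIV. g x $ j $ l * matrix_inv (g x) $ l $ m) = (if j = m then 1 else 0)" for m
    by (simp add: matrix_matrix_mult_def mat_def vec_eq_iff)
  have "(\<Sum>l\<in>UNIV. christoffel g x l k i * g x $ l $ j) =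
      (\<Sum>l\<in>UNIV. \<Sum>m\<in>UNIV. g x $ j $ l * matrix_inv (g x) $ l $ m * P m / 2)"
    unfolding christoffel_def P_def[symmetric]
    by (simp add: g_nth_sym[OF x, of j] sum_divide_distrib sum_distrib_left sum_distrib_right mult_ac)
  also have "\<dots> = (\<Sum>m\<in>UNIV. (\<Sum>l\<in>UNIV. g x $ j $ l * matrix_inv (g x) $ l $ m) * P m / 2)"
    by (subst sum.swap) (simp add: sum_distrib_right sum_divide_distrib)
  also have "\<dots> = (\<Sum>m\<in>UNIV. (if j = m then P m / 2 else 0))"
    unfolding delta by (rule sum.cong) auto
  also have "\<dots> = P j / 2" by simp
  finally show ?thesis by (simp add: P_def)
qed

lemma nabla_metric:
  assumes x: "x \<in> M" shows "nabla_form2 g g x = 0"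
proof -
  have right: "(\<Sum>l\<in>UNIV. christoffel g x l k j * g x $ i $ l) =
      (pderiv_at k g x $ j $ i + pderiv_at j g x $ k $ i - pderiv_at i g x $ k $ j) / 2" for i j k
    using christoffel_lower[OF x, of k j i] by (simp add: g_nth_sym[OF x, of i])
  have "nabla_form2 g g x $ k $ i $ j = 0" for k i j
    using pderiv_at_g_sym[OF x, of k i j]
    by (simp add: nabla_form2_def right christoffel_lower[OF x] field_simps)
  then show ?thesis by (simp add: vec_eq_iff)
qed

lemma metric_leibniz_zero:
  assumes x: "x \<in> M" and YZ: "Y differentiable (at x)" "Z differentiable (at x)"
    and W: "open W" "x \<in> W" and "\<And>y. y \<in> W \<Longrightarrow> form2 (cmat (g y)) (Y y) (Z y) = 0"
  shows "form2 (cmat (g x)) (cov_deriv g X Y x) (Z x) + form2 (cmat (g x)) (Y x) (cov_deriv g X Z x) = 0"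
proof -
  have "form3 (cten (nabla_form2 g g x)) X (Y x) (Z x) = 0"
    by (simp add: nabla_metric[OF x] form3_def cten_def cmat_def cvec_def)
  then show ?thesis
    using cov_deriv_leibniz_zero[OF g_differentiable[OF x] YZ W, where g = g and X = X] assms(6) by simp
qed

lemma conn_term_sym: "x \<in> M \<Longrightarrow> conn_term g x X Y = conn_term g x Y X"
  unfolding conn_term_def
  by (simp add: vec_eq_iff, subst sum.swap)
    (simp add: christoffel_sym mult_ac)

lemma lie_bracket_cov_deriv:
  "x \<in> M \<Longrightarrow> lie_bracket X Y x = cov_deriv g (X x) Y x - cov_deriv g (Y x) X x"
  by (simp add: lie_bracket_def cov_deriv_def dir_deriv_def conn_term_sym[of x "X x"])

text \<open>
  Summing the equation cyclically gives \<open>\<tau> = d\<phi>\<close>, because the connection is torsion-free and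
  the \<open>\<kappa>\<close>-terms cancel. Two orthogonality assumptions remove the \<open>\<kappa>\<close>-terms from the equation
  itself.
\<close>

lemma conformal_killing_yano_nabla:
  assumes cky: "conformal_killing_yano M g \<phi>" and x: "x \<in> M"
    and XY: "form2 (cmat (g x)) X Y = 0" and XZ: "form2 (cmat (g x)) X Z = 0"
  shows "form3 (cten (nabla_form2 g \<phi> x)) X Y Z = form3 (cten (ext_deriv2 \<phi> x)) X Y Z / 3"
proof -
  obtain \<tau> \<kappa> where \<tau>: "three_form M \<tau>" and \<phi>: "two_form M \<phi>"
    and eq: "\<And>X Y Z. form3 (nabla_form2 g \<phi> x) X Y Z = 1 / 3 * form3 (\<tau> x) X Y Z +
          1 / (real CARD('n) - 1) * wedge11 (form2 (g x) X) (form1 (\<kappa> x)) Y Z"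
    using cky x unfolding conformal_killing_yano_def by blast
  define b where "b = 1 / (real CARD('n) - 1)"
  have N: "nabla_form2 g \<phi> x $ k $ i $ j =
      \<tau> x $ k $ i $ j / 3 + b * (g x $ k $ i * \<kappa> x $ j - g x $ k $ j * \<kappa> x $ i)" for k i j
    using eq[of "axis k 1" "axis i 1" "axis j 1"] by (simp add: wedge11_def b_def)
  have anti: "\<phi> x $ i $ j = - \<phi> x $ j $ i" for i j
    using \<phi> x unfolding two_form_def by blast
  have d: "ext_deriv2 \<phi> x $ k $ i $ j = nabla_form2 g \<phi> x $ k $ i $ j + nabla_form2 g \<phi> x $ i $ j $ k
      + nabla_form2 g \<phi> x $ j $ k $ i" for k i j
  proof -
    have "(\<Sum>l\<in>UNIV. christoffel g x l k i * \<phi> x $ l $ j) = - (\<Sum>l\<in>UNIV. christoffel g x l i k * \<phi> x $ j $ l)"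
      for i j k
      unfolding sum_negf[symmetric] by (rule sum.cong) (simp_all add: anti[of _ j] christoffel_sym[OF x, of _ i])
    then show ?thesis
      by (simp add: ext_deriv2_def nabla_form2_def)
  qed
  have \<tau>_anti: "\<tau> x $ i $ j $ k = - \<tau> x $ j $ i $ k" "\<tau> x $ i $ j $ k = - \<tau> x $ i $ k $ j" for i j k
    using \<tau> x unfolding three_form_def by blast+
  have \<tau>d: "\<tau> x $ k $ i $ j = ext_deriv2 \<phi> x $ k $ i $ j" for k i j
  proof -
    have "\<tau> x $ i $ j $ k = \<tau> x $ k $ i $ j" "\<tau> x $ j $ k $ i = \<tau> x $ k $ i $ j"
      using \<tau>_anti by (metis minus_minus)+
    then show ?thesis
      unfolding d N by (simp add: g_nth_sym[OF x, of k] g_nth_sym[OF x, of i j] algebra_simps)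
  qed
  define K where "K = cvec (\<kappa> x)"
  have c: "cten (nabla_form2 g \<phi> x) $ k $ i $ j = cten (ext_deriv2 \<phi> x) $ k $ i $ j / 3
      + complex_of_real b * (cmat (g x) $ k $ i * K $ j - cmat (g x) $ k $ j * K $ i)" for k i j
    using N[of k i j] unfolding \<tau>d by (simp add: cten_def cmat_def cvec_def K_def)
  have 1: "(\<Sum>k\<in>UNIV. \<Sum>i\<in>UNIV. \<Sum>j\<in>UNIV. cmat (g x) $ k $ i * K $ j * X $ k * Y $ i * Z $ j) =
      form2 (cmat (g x)) X Y * form1 K Z"
    by (simp add: form2_def form1_def sum_distrib_left sum_distrib_right mult_ac)
  have 2: "(\<Sum>k\<in>UNIV. \<Sum>i\<in>UNIV. \<Sum>j\<in>UNIV. cmat (g x) $ k $ j * K $ i * X $ k * Y $ i * Z $ j) =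
      form2 (cmat (g x)) X Z * form1 K Y"
  proof -
    have "(\<Sum>k\<in>UNIV. \<Sum>i\<in>UNIV. \<Sum>j\<in>UNIV. cmat (g x) $ k $ j * K $ i * X $ k * Y $ i * Z $ j) =
      (\<Sum>k\<in>UNIV. \<Sum>j\<in>UNIV. \<Sum>i\<in>UNIV. cmat (g x) $ k $ j * K $ i * X $ k * Y $ i * Z $ j)"
      by (rule sum.cong[OF refl], rule sum.swap)
    also have "\<dots> = form2 (cmat (g x)) X Z * form1 K Y"
      by (simp add: form2_def form1_def sum_distrib_left sum_distrib_right mult_ac)
    finally show ?thesis .
  qed
  have "form3 (cten (nabla_form2 g \<phi> x)) X Y Z = form3 (cten (ext_deriv2 \<phi> x)) X Y Z / 3
    + complex_of_real b * (form2 (cmat (g x)) X Y * form1 K Z - form2 (cmat (g x)) X Z * form1 K Y)"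
    unfolding 1[symmetric] 2[symmetric] unfolding form3_def c sum_subtractf[symmetric]
      sum_divide_distrib sum_distrib_left sum.distrib[symmetric]
    by (intro sum.cong refl) (simp add: algebra_simps)
  then show ?thesis by (simp add: XY XZ)
qed

end


section \<open>Adapted frames\<close>

locale cky_frame = metric_chart M g
  for M :: "(real^'n::finite) set" and g :: "real^'n \<Rightarrow> real^'n^'n" +
  fixes \<phi> :: "real^'n \<Rightarrow> real^'n^'n"
    and lam :: "'m::finite \<Rightarrow> real^'n \<Rightarrow> complex"
    and c :: real
    and e0 V0 :: "real^'n \<Rightarrow> complex^'n"
    and \<theta>u \<theta>l Vl Vu :: "'m \<Rightarrow> real^'n \<Rightarrow> complex^'n"
  assumes cky: "conformal_killing_yano M g \<phi>"
    and distinct: "distinct_eigenvalues M g \<phi> lam"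
    and coframe: "adapted_coframe M g \<phi> lam c e0 \<theta>u \<theta>l"
    and dual: "dual_frame M e0 \<theta>u \<theta>l V0 Vl Vu"
    and d\<phi>_cond: "\<forall>x\<in>M. \<forall>\<mu>. \<forall>X Y Z.
           wedge12 (form1 (\<theta>u \<mu> x)) (form3 (cten (ext_deriv2 \<phi> x)) (Vu \<mu> x)) X Y Z = 0 \<and>
           wedge12 (form1 (\<theta>l \<mu> x)) (form3 (cten (ext_deriv2 \<phi> x)) (Vl \<mu> x)) X Y Z = 0"
begin

text \<open>
  The Boolean selects the member of a pair, so that \<open>\<theta> b \<mu>\<close> is dual to \<open>V b \<mu>\<close> while \<open>g\<close> pairs
  \<open>V b \<mu>\<close> with \<open>V (\<not> b) \<mu>\<close>. A distribution is then a choice \<open>s\<close> of one Boolean for each \<open>\<mu>\<close>.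
\<close>

definition V :: "bool \<Rightarrow> 'm \<Rightarrow> real^'n \<Rightarrow> complex^'n" where
  "V b \<mu> x = (if b then Vl \<mu> x else Vu \<mu> x)"

definition \<theta> :: "bool \<Rightarrow> 'm \<Rightarrow> real^'n \<Rightarrow> complex^'n" where
  "\<theta> b \<mu> x = (if b then \<theta>u \<mu> x else \<theta>l \<mu> x)"

text \<open>Up to the factor \<open>2 / c\<close>, the eigenvalue of \<open>\<phi>\<close> on \<open>V b \<mu>\<close>.\<close>

definition \<Lambda> :: "bool \<Rightarrow> 'm \<Rightarrow> real^'n \<Rightarrow> complex" where
  "\<Lambda> b \<mu> x = (if b then lam \<mu> x else - lam \<mu> x)"

definition \<D> :: "('m \<Rightarrow> bool) \<Rightarrow> 'n distribution" where
  "\<D> s x = (if x \<in> M then vec.span (range (\<lambda>\<mu>. V (s \<mu>) \<mu> x)) else {})"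

lemma frame_distributions_eq: "frame_distributions M Vl Vu = range \<D>"
proof -
  have "\<D> = (\<lambda>s x. if x \<in> M then vec.span (range (\<lambda>\<mu>. if s \<mu> then Vl \<mu> x else Vu \<mu> x)) else {})"
    by (intro ext) (simp add: \<D>_def V_def)
  then show ?thesis by (simp add: frame_distributions_def)
qed

lemma smooth_V: "smooth_on M (V b \<mu>)" and smooth_V0: "smooth_on M V0"
  and smooth_\<theta>: "smooth_on M (\<theta> b \<mu>)"
proof -
  have "V b \<mu> = (if b then Vl \<mu> else Vu \<mu>)" "\<theta> b \<mu> = (if b then \<theta>u \<mu> else \<theta>l \<mu>)"
    by (auto simp: V_def \<theta>_def fun_eq_iff)
  then show "smooth_on M (V b \<mu>)" "smooth_on M V0" "smooth_on M (\<theta> b \<mu>)"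
    using dual coframe by (auto simp: dual_frame_def adapted_coframe_def)
qed

lemma V_differentiable: "x \<in> M \<Longrightarrow> V b \<mu> differentiable (at x)"
  and V0_differentiable: "x \<in> M \<Longrightarrow> V0 differentiable (at x)"
  and \<theta>_differentiable: "x \<in> M \<Longrightarrow> \<theta> b \<mu> differentiable (at x)"
  by (rule smooth_on_differentiable[OF smooth_V] smooth_on_differentiable[OF smooth_V0]
      smooth_on_differentiable[OF smooth_\<theta>]; assumption)+

lemma \<phi>_differentiable: "x \<in> M \<Longrightarrow> \<phi> differentiable (at x)"
  using cky by (auto simp: conformal_killing_yano_def two_form_def intro: smooth_on_differentiable)

text \<open>
  The excluded case \<open>\<mu> = \<nu>\<close>, \<open>a \<noteq> b\<close> is that of the two members of one pair, the only
  eigenvectors with opposite eigenvalues.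
\<close>

lemma \<Lambda>_sum_nonzero: "x \<in> M \<Longrightarrow> \<mu> \<noteq> \<nu> \<or> a = b \<Longrightarrow> \<Lambda> a \<mu> x + \<Lambda> b \<nu> x \<noteq> 0"
proof
  assume x: "x \<in> M" and ne: "\<mu> \<noteq> \<nu> \<or> a = b" and "\<Lambda> a \<mu> x + \<Lambda> b \<nu> x = 0"
  then have eq: "\<Lambda> a \<mu> x = - \<Lambda> b \<nu> x" by (simp add: eq_neg_iff_add_eq_0)
  have "lam \<mu> x \<noteq> 0" "\<mu> \<noteq> \<nu> \<Longrightarrow> lam \<mu> x \<noteq> lam \<nu> x" "\<mu> \<noteq> \<nu> \<Longrightarrow> lam \<mu> x \<noteq> - lam \<nu> x"
    using distinct x unfolding distinct_eigenvalues_def by blast+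
  moreover from this(3) have "\<mu> \<noteq> \<nu> \<Longrightarrow> - lam \<mu> x \<noteq> lam \<nu> x" by (metis minus_minus)
  ultimately show False
    using ne eq by (cases a; cases b; cases "\<mu> = \<nu>") (simp_all add: \<Lambda>_def)
qed

lemma \<Lambda>_nonzero: "x \<in> M \<Longrightarrow> \<Lambda> a \<mu> x \<noteq> 0"
  using distinct unfolding distinct_eigenvalues_def \<Lambda>_def by auto

lemma frame_dual [simp]:
  assumes "x \<in> M"
  shows "form1 (\<theta> a \<mu> x) (V b \<nu> x) = (if a = b \<and> \<mu> = \<nu> then 1 else 0)"
    "form1 (\<theta> a \<mu> x) (V0 x) = 0" "form1 (e0 x) (V b \<nu> x) = 0" "form1 (e0 x) (V0 x) = 1"
  using dual assms unfolding dual_frame_def V_def \<theta>_def by auto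

lemma g_eq:
  assumes "x \<in> M"
  shows "form2 (cmat (g x)) X Y = complex_of_real c / 2 * (\<Sum>\<mu>\<in>UNIV.
      form1 (\<theta> True \<mu> x) X * form1 (\<theta> False \<mu> x) Y + form1 (\<theta> False \<mu> x) X * form1 (\<theta> True \<mu> x) Y)
    + form1 (e0 x) X * form1 (e0 x) Y"
proof -
  have "form2 (cmat (g x)) X Y =
      complex_of_real c * (\<Sum>\<mu>\<in>UNIV. sym_prod (form1 (\<theta>u \<mu> x)) (form1 (\<theta>l \<mu> x)) X Y) +
      sym_prod (form1 (e0 x)) (form1 (e0 x)) X Y"
    using coframe assms unfolding adapted_coframe_def by blast
  then show ?thesis
    by (simp add: sym_prod_def \<theta>_def sum_divide_distrib[symmetric] mult_ac)
qed

lemma \<phi>_eq: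
  assumes "x \<in> M"
  shows "form2 (cmat (\<phi> x)) X Y = (\<Sum>\<mu>\<in>UNIV. lam \<mu> x *
      (form1 (\<theta> True \<mu> x) X * form1 (\<theta> False \<mu> x) Y - form1 (\<theta> False \<mu> x) X * form1 (\<theta> True \<mu> x) Y))"
proof -
  have "form2 (cmat (\<phi> x)) X Y =
      (\<Sum>\<mu>\<in>UNIV. lam \<mu> x * wedge11 (form1 (\<theta>u \<mu> x)) (form1 (\<theta>l \<mu> x)) X Y)"
    using coframe assms unfolding adapted_coframe_def by blast
  then show ?thesis
    by (simp add: wedge11_def \<theta>_def mult_ac)
qed

lemma g_sym_form: "x \<in> M \<Longrightarrow> form2 (cmat (g x)) X Y = form2 (cmat (g x)) Y X"
  by (simp add: form2_cmat_sym g_sym)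

lemma \<phi>_skew_form: "x \<in> M \<Longrightarrow> form2 (cmat (\<phi> x)) X Y = - form2 (cmat (\<phi> x)) Y X"
  unfolding \<phi>_eq sum_negf[symmetric] by (intro sum.cong refl) (simp add: algebra_simps)

text \<open>Both tensors pair a frame vector with the covector of its partner only, so the frame
  consists of eigenvectors of \<open>\<phi>\<close> relative to \<open>g\<close>.\<close>

lemma g_V:
  assumes x: "x \<in> M"
  shows "form2 (cmat (g x)) (V b \<mu> x) Y = complex_of_real c / 2 * form1 (\<theta> (\<not> b) \<mu> x) Y"
proof -
  have "(\<Sum>\<nu>\<in>UNIV. form1 (\<theta> True \<nu> x) (V b \<mu> x) * form1 (\<theta> False \<nu> x) Y
      + form1 (\<theta> False \<nu> x) (V b \<mu> x) * form1 (\<theta> True \<nu> x) Y)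
    = (\<Sum>\<nu>\<in>UNIV. if \<nu> = \<mu> then form1 (\<theta> (\<not> b) \<nu> x) Y else 0)"
    by (intro sum.cong refl) (cases b; simp add: x)
  then show ?thesis by (simp add: g_eq[OF x] x)
qed

lemma g_V0: "x \<in> M \<Longrightarrow> form2 (cmat (g x)) (V0 x) Y = form1 (e0 x) Y"
  by (simp add: g_eq)

lemma \<phi>_V:
  assumes x: "x \<in> M"
  shows "form2 (cmat (\<phi> x)) (V b \<mu> x) Y = \<Lambda> b \<mu> x * form1 (\<theta> (\<not> b) \<mu> x) Y"
proof -
  have "form2 (cmat (\<phi> x)) (V b \<mu> x) Y
    = (\<Sum>\<nu>\<in>UNIV. if \<nu> = \<mu> then \<Lambda> b \<nu> x * form1 (\<theta> (\<not> b) \<nu> x) Y else 0)"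
    unfolding \<phi>_eq[OF x] \<Lambda>_def by (intro sum.cong refl) (cases b; simp add: x)
  then show ?thesis by simp
qed

lemma \<phi>_V0: "x \<in> M \<Longrightarrow> form2 (cmat (\<phi> x)) (V0 x) Y = 0"
  by (simp add: \<phi>_eq)

text \<open>If \<open>c = 0\<close>, then \<open>g\<close> is the square of \<open>e0\<close>, which is degenerate.\<close>

lemma c_nonzero:
  assumes x: "x \<in> M"
  shows "c \<noteq> 0"
proof
  assume "c = 0"
  fix \<mu> :: 'm
  have "form2 (cmat (g x)) X (V True \<mu> x) = 0" for X
    using g_V[OF x, of True \<mu> X] g_sym_form[OF x, of X] \<open>c = 0\<close> by simp
  then have "V True \<mu> x = 0"
    using form2_cmat_nondegenerate[OF g_inv[OF x]] by blast
  then show False using frame_dual(1)[OF x, of True \<mu> True \<mu>] by simp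
qed

lemma coframe_separates:
  assumes x: "x \<in> M" and "form1 (e0 x) X = 0" and "\<And>b \<mu>. form1 (\<theta> b \<mu> x) X = 0"
  shows "X = 0"
proof -
  have "vec.span (insert (e0 x) (range (\<lambda>\<mu>. \<theta>u \<mu> x) \<union> range (\<lambda>\<mu>. \<theta>l \<mu> x))) = UNIV"
    using coframe x unfolding adapted_coframe_def by blast
  moreover have "vec.span (insert (e0 x) (range (\<lambda>\<mu>. \<theta>u \<mu> x) \<union> range (\<lambda>\<mu>. \<theta>l \<mu> x)))
      \<subseteq> {\<alpha>. form1 \<alpha> X = 0}"
  proof (rule vec.span_minimal)
    show "insert (e0 x) (range (\<lambda>\<mu>. \<theta>u \<mu> x) \<union> range (\<lambda>\<mu>. \<theta>l \<mu> x)) \<subseteq> {\<alpha>. form1 \<alpha> X = 0}"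
      using assms(2) assms(3)[of True] assms(3)[of False] by (auto simp: \<theta>_def)
    show "vec.subspace {\<alpha>. form1 \<alpha> X = 0}"
      by (rule vec.subspaceI) auto
  qed
  ultimately have ann: "form1 \<alpha> X = 0" for \<alpha> by auto
  have "X $ i = 0" for i
    using ann[of "axis i 1"] form1_axis[of X i] by (simp add: form1_def mult.commute)
  then show ?thesis by (simp add: vec_eq_iff)
qed

lemma coframe_eqI:
  assumes x: "x \<in> M" and "form1 (e0 x) X = form1 (e0 x) Y"
    and "\<And>b \<mu>. form1 (\<theta> b \<mu> x) X = form1 (\<theta> b \<mu> x) Y"
  shows "X = Y"
  using coframe_separates[OF x, of "X - Y"] assms by simp

lemma kernel_eq:
  assumes x: "x \<in> M"
  shows "form2_kernel \<phi> x = vec.span {V0 x}"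
proof (intro equalityI subsetI)
  fix X assume "X \<in> form2_kernel \<phi> x"
  then have "form2 (cmat (\<phi> x)) (V b \<mu> x) X = 0" for b \<mu>
    using \<phi>_skew_form[OF x, of "V b \<mu> x" X] by (simp add: form2_kernel_def)
  then have "form1 (\<theta> (\<not> b) \<mu> x) X = 0" for b \<mu>
    using \<phi>_V[OF x] \<Lambda>_nonzero[OF x] by simp
  from this[of "\<not> _"] have "form1 (\<theta> b \<mu> x) X = 0" for b \<mu> by simp
  then have "X = form1 (e0 x) X *s V0 x" using x by (intro coframe_eqI[OF x]) simp_all
  then show "X \<in> vec.span {V0 x}" by (metis vec.span_base vec.span_scale singletonI)
next
  fix X assume "X \<in> vec.span {V0 x}"
  then show "X \<in> form2_kernel \<phi> x"
    by (auto simp: vec.span_singleton form2_kernel_def \<phi>_V0[OF x])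
qed

lemma span_\<D>: "x \<in> M \<Longrightarrow> \<D> s x = vec.span (range (\<lambda>\<mu>. V (s \<mu>) \<mu> x))"
  by (simp add: \<D>_def)

lemma \<D>_subspace: "x \<in> M \<Longrightarrow> vec.subspace (\<D> s x)"
  by (simp add: span_\<D>)

lemma V_in_\<D>: "x \<in> M \<Longrightarrow> V (s \<mu>) \<mu> x \<in> \<D> s x"
  by (simp add: span_\<D> vec.span_base)

lemma \<D>_induct:
  assumes "x \<in> M" "X \<in> \<D> s x" and "vec.subspace {Y. P Y}" and "\<And>\<mu>. P (V (s \<mu>) \<mu> x)"
  shows "P X"
proof -
  have "vec.span (range (\<lambda>\<mu>. V (s \<mu>) \<mu> x)) \<subseteq> {Y. P Y}"
    using assms(3,4) by (intro vec.span_minimal) auto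
  then show ?thesis using assms(1,2) by (auto simp: span_\<D>)
qed

text \<open>
  The dual description by covectors makes membership an equation, which can be differentiated
  and conjugated.
\<close>

lemma mem_\<D>_iff:
  assumes x: "x \<in> M"
  shows "X \<in> \<D> s x \<longleftrightarrow> form1 (e0 x) X = 0 \<and> (\<forall>\<mu>. form1 (\<theta> (\<not> s \<mu>) \<mu> x) X = 0)"
proof
  assume "X \<in> \<D> s x"
  then show "form1 (e0 x) X = 0 \<and> (\<forall>\<mu>. form1 (\<theta> (\<not> s \<mu>) \<mu> x) X = 0)"
    by (rule \<D>_induct[OF x]) (auto intro!: vec.subspaceI simp: x)
next
  assume ann: "form1 (e0 x) X = 0 \<and> (\<forall>\<mu>. form1 (\<theta> (\<not> s \<mu>) \<mu> x) X = 0)"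
  have "form1 (\<theta> b \<mu> x) X = form1 (\<theta> b \<mu> x) (\<Sum>\<nu>\<in>UNIV. form1 (\<theta> (s \<nu>) \<nu> x) X *s V (s \<nu>) \<nu> x)" for b \<mu>
  proof -
    have eq: "form1 (\<theta> b \<mu> x) (\<Sum>\<nu>\<in>UNIV. form1 (\<theta> (s \<nu>) \<nu> x) X *s V (s \<nu>) \<nu> x)
      = (\<Sum>\<nu>\<in>UNIV. if \<nu> = \<mu> then (if b = s \<nu> then form1 (\<theta> (s \<nu>) \<nu> x) X else 0) else 0)"
      unfolding form1_sum by (intro sum.cong refl) (simp add: x)
    show ?thesis
    proof (cases "b = s \<mu>")
      case False
      then have "b = (\<not> s \<mu>)" by auto
      then show ?thesis unfolding eq using ann by simp
    next
      case True
      then show ?thesis unfolding eq by simp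
    qed
  qed
  then have "X = (\<Sum>\<nu>\<in>UNIV. form1 (\<theta> (s \<nu>) \<nu> x) X *s V (s \<nu>) \<nu> x)"
    by (rule coframe_eqI[OF x, rotated]) (simp add: ann x)
  also have "\<dots> \<in> \<D> s x"
    using V_in_\<D>[OF x] \<D>_subspace[OF x] by (intro vec.subspace_sum vec.subspace_scale)
  finally show "X \<in> \<D> s x" .
qed

lemma \<D>_isotropic:
  assumes x: "x \<in> M" and "X \<in> \<D> s x" and Y: "Y \<in> \<D> s x"
  shows "form2 (cmat (g x)) X Y = 0"
proof (rule \<D>_induct[OF x assms(2), where P = "\<lambda>X. form2 (cmat (g x)) X Y = 0"])
  show "vec.subspace {X. form2 (cmat (g x)) X Y = 0}" by (rule vec.subspaceI) auto
  show "form2 (cmat (g x)) (V (s \<mu>) \<mu> x) Y = 0" for \<mu>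
    using Y by (simp add: g_V[OF x] mem_\<D>_iff[OF x])
qed

lemma \<D>_orth_kernel:
  assumes x: "x \<in> M"
  shows "\<D> s x \<subseteq> orth_complement g (form2_kernel \<phi>) x"
proof
  fix X assume "X \<in> \<D> s x"
  then have "form2 (cmat (g x)) X (V0 x) = 0"
    using g_sym_form[OF x, of X "V0 x"] by (simp add: mem_\<D>_iff[OF x] g_V0[OF x])
  then show "X \<in> orth_complement g (form2_kernel \<phi>) x"
    by (auto simp: orth_complement_def kernel_eq[OF x] vec.span_singleton)
qed

lemma inj_\<D>:
  assumes "M \<noteq> {}"
  shows "inj \<D>"
proof (rule injI, rule ext)
  fix s s' \<mu> assume eq: "\<D> s = \<D> s'"
  obtain x where x: "x \<in> M" using assms by blast
  have "V (s \<mu>) \<mu> x \<in> \<D> s' x" using V_in_\<D>[OF x, of s] eq by simp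
  then have "form1 (\<theta> (\<not> s' \<mu>) \<mu> x) (V (s \<mu>) \<mu> x) = 0" using mem_\<D>_iff[OF x] by blast
  then show "s \<mu> = s' \<mu>" using x by (auto split: if_splits)
qed

lemma \<D>_dim:
  assumes x: "x \<in> M"
  shows "vec.dim (\<D> s x) = CARD('m)"
proof -
  define v where "v \<mu> = V (s \<mu>) \<mu> x" for \<mu>
  have dual_v: "form1 (\<theta> (s \<mu>) \<mu> x) (v \<nu>) = (if \<mu> = \<nu> then 1 else 0)" for \<mu> \<nu>
    by (auto simp: v_def x)
  have inj: "inj v" by (rule injI) (metis dual_v zero_neq_one)
  have "vec.independent (range v)"
  proof (rule vec.independent_if_scalars_zero)
    fix f X assume "(\<Sum>X\<in>range v. f X *s X) = 0" "X \<in> range v"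
    then obtain \<mu> where \<mu>: "X = v \<mu>" by blast
    have "0 = form1 (\<theta> (s \<mu>) \<mu> x) (\<Sum>\<nu>\<in>UNIV. f (v \<nu>) *s v \<nu>)"
      using \<open>(\<Sum>X\<in>range v. f X *s X) = 0\<close> by (simp add: sum.reindex[OF inj] del: form1_sum)
    also have "\<dots> = (\<Sum>\<nu>\<in>UNIV. if \<nu> = \<mu> then f (v \<nu>) else 0)"
      unfolding form1_sum by (intro sum.cong refl) (simp add: dual_v)
    finally show "f X = 0" using \<mu> by simp
  qed simp
  then have "vec.dim (range v) = card (range v)" by (rule vec.dim_eq_card_independent)
  then show ?thesis
    using inj by (simp add: span_\<D>[OF x] vec.dim_span card_image v_def[symmetric])
qed

lemma \<D>_smooth: "smooth_distribution M CARD('m) (\<D> s)"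
  unfolding smooth_distribution_def
proof (intro conjI ballI)
  obtain h :: "nat \<Rightarrow> 'm" where "bij_betw h {0..<CARD('m)} UNIV"
    using ex_bij_betw_nat_finite[of "UNIV :: 'm set"] by auto
  then have h: "h ` {..<CARD('m)} = UNIV"
    by (simp add: bij_betw_def atLeast0LessThan)
  fix x assume x: "x \<in> M"
  have "\<D> s y = vec.span ((\<lambda>i. V (s (h i)) (h i) y) ` {..<CARD('m)})" if "y \<in> M" for y
  proof -
    have "range (\<lambda>\<mu>. V (s \<mu>) \<mu> y) = (\<lambda>\<mu>. V (s \<mu>) \<mu> y) ` h ` {..<CARD('m)}" by (simp only: h)
    then show ?thesis by (simp add: span_\<D>[OF that] image_image)
  qed
  then show "\<exists>W X. open W \<and> x \<in> W \<and> W \<subseteq> M \<and> (\<forall>i<CARD('m). smooth_on W (X i)) \<and>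
        (\<forall>y\<in>W. \<D> s y = vec.span ((\<lambda>i. X i y) ` {..<CARD('m)}))"
    using x open_M smooth_V
    by (intro exI[of _ M] exI[of _ "\<lambda>i. V (s (h i)) (h i)"]) auto
qed (auto simp: \<D>_subspace \<D>_dim)


section \<open>The distributions are parallel along themselves\<close>

text \<open>Evaluating \<open>\<theta>\<^sup>\<mu> \<and> \<tau>(V\<^sup>\<mu>, \<cdot>, \<cdot>)\<close> on \<open>V\<^sub>\<mu>\<close> and two vectors that \<open>\<theta>\<^sup>\<mu>\<close> kills leaves one term.\<close>

lemma d\<phi>_vanishes:
  assumes x: "x \<in> M" and Y: "form1 (\<theta> (\<not> b) \<mu> x) Y = 0" and Z: "form1 (\<theta> (\<not> b) \<mu> x) Z = 0"
  shows "form3 (cten (ext_deriv2 \<phi> x)) (V b \<mu> x) Y Z = 0"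
proof -
  have "wedge12 (form1 (\<theta> (\<not> b) \<mu> x)) (form3 (cten (ext_deriv2 \<phi> x)) (V b \<mu> x)) (V (\<not> b) \<mu> x) Y Z = 0"
    using bspec[OF d\<phi>_cond x, THEN spec, of \<mu>] by (cases b) (simp_all add: V_def \<theta>_def)
  then show ?thesis using x by (simp add: wedge12_def Y Z)
qed

text \<open>
  The argument \<open>Z = V0\<close> is admitted because \<open>V0\<close>, like the vectors of the distribution, is
  orthogonal to it and annihilated by the covectors \<open>\<theta> (\<not> s \<rho>) \<rho>\<close>.
\<close>

lemma nabla_\<phi>_vanishes:
  assumes x: "x \<in> M" and Y: "Y \<in> \<D> s x" and Z: "Z \<in> \<D> s x \<or> Z = V0 x"
  shows "form3 (cten (nabla_form2 g \<phi> x)) (V (s \<rho>) \<rho> x) Y Z = 0"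
proof -
  have YZ: "form1 (\<theta> (\<not> s \<rho>) \<rho> x) Y = 0" "form1 (\<theta> (\<not> s \<rho>) \<rho> x) Z = 0"
    using Y Z x by (auto simp: mem_\<D>_iff[OF x])
  then have orth: "form2 (cmat (g x)) (V (s \<rho>) \<rho> x) Y = 0" "form2 (cmat (g x)) (V (s \<rho>) \<rho> x) Z = 0"
    by (simp_all add: g_V[OF x])
  show ?thesis
    using conformal_killing_yano_nabla[OF cky x orth] d\<phi>_vanishes[OF x YZ] by simp
qed

text \<open>
  Write \<open>V\<^sub>\<mu>\<close> for \<open>V (s \<mu>) \<mu>\<close>, with eigenvalue \<open>\<Lambda>\<^sub>\<mu>\<close>, and let \<open>p\<close> and \<open>q\<close> be the pairings of \<open>V\<^sub>\<mu>\<close> with \<open>\<nabla>\<^sub>X V\<^sub>\<nu>\<close> and of \<open>V\<^sub>\<nu>\<close> with \<open>\<nabla>\<^sub>X V\<^sub>\<mu>\<close>.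
  Differentiating \<open>\<phi>(V\<^sub>\<mu>, V\<^sub>\<nu>) = 0\<close> gives \<open>\<Lambda>\<^sub>\<mu> p = \<Lambda>\<^sub>\<nu> q\<close>, as \<open>\<nabla>\<^sub>X\<phi>\<close> does not
  contribute, and differentiating \<open>g(V\<^sub>\<mu>, V\<^sub>\<nu>) = 0\<close> gives \<open>p + q = 0\<close>.
\<close>

lemma \<theta>_cov_deriv_V:
  assumes x: "x \<in> M"
  shows "form1 (\<theta> (\<not> s \<mu>) \<mu> x) (cov_deriv g (V (s \<rho>) \<rho> x) (V (s \<nu>) \<nu>) x) = 0"
proof -
  let ?X = "V (s \<rho>) \<rho> x"
  let ?p = "form1 (\<theta> (\<not> s \<mu>) \<mu> x) (cov_deriv g ?X (V (s \<nu>) \<nu>) x)"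
  let ?q = "form1 (\<theta> (\<not> s \<nu>) \<nu> x) (cov_deriv g ?X (V (s \<mu>) \<mu>) x)"
  have "form2 (cmat (\<phi> y)) (V (s \<mu>) \<mu> y) (V (s \<nu>) \<nu> y) = 0"
    "form2 (cmat (g y)) (V (s \<mu>) \<mu> y) (V (s \<nu>) \<nu> y) = 0" if "y \<in> M" for y
    using that by (auto simp: \<phi>_V g_V)
  note zero = this
  have "form2 (cmat (\<phi> x)) (cov_deriv g ?X (V (s \<mu>) \<mu>) x) (V (s \<nu>) \<nu> x)
      + form2 (cmat (\<phi> x)) (V (s \<mu>) \<mu> x) (cov_deriv g ?X (V (s \<nu>) \<nu>) x) = 0"
    using cov_deriv_leibniz_zero[OF \<phi>_differentiable[OF x] V_differentiable[OF x]
        V_differentiable[OF x] open_M x zero(1), where g = g and X = ?X]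
      nabla_\<phi>_vanishes[OF x V_in_\<D>[OF x, of s \<mu>] disjI1[OF V_in_\<D>[OF x, of s \<nu>]], of \<rho>] by simp
  then have 1: "- \<Lambda> (s \<nu>) \<nu> x * ?q + \<Lambda> (s \<mu>) \<mu> x * ?p = 0"
    unfolding \<phi>_skew_form[OF x, of _ "V (s \<nu>) \<nu> x"] by (simp add: \<phi>_V[OF x])
  have "form2 (cmat (g x)) (cov_deriv g ?X (V (s \<mu>) \<mu>) x) (V (s \<nu>) \<nu> x)
      + form2 (cmat (g x)) (V (s \<mu>) \<mu> x) (cov_deriv g ?X (V (s \<nu>) \<nu>) x) = 0"
    by (rule metric_leibniz_zero[OF x V_differentiable[OF x] V_differentiable[OF x] open_M x zero(2)])
  then have "complex_of_real c / 2 * (?q + ?p) = 0"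
    unfolding g_sym_form[OF x, of _ "V (s \<nu>) \<nu> x"] by (simp add: g_V[OF x] distrib_left)
  then have "?q + ?p = 0" using c_nonzero[OF x] by simp
  then have "?q = - ?p" by (simp only: eq_neg_iff_add_eq_0)
  from 1[unfolded this] have "(\<Lambda> (s \<mu>) \<mu> x + \<Lambda> (s \<nu>) \<nu> x) * ?p = 0"
    by (simp add: algebra_simps)
  moreover have "\<Lambda> (s \<mu>) \<mu> x + \<Lambda> (s \<nu>) \<nu> x \<noteq> 0" by (rule \<Lambda>_sum_nonzero[OF x]) auto
  ultimately show ?thesis by simp
qed

text \<open>Here \<open>\<phi>\<close> alone suffices, because \<open>\<phi>(\<cdot>, V0) = 0\<close> removes one of the two terms.\<close>

lemma \<theta>_cov_deriv_V0:
  assumes x: "x \<in> M"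
  shows "form1 (\<theta> (\<not> s \<mu>) \<mu> x) (cov_deriv g (V (s \<rho>) \<rho> x) V0 x) = 0"
proof -
  have zero: "form2 (cmat (\<phi> y)) (V (s \<mu>) \<mu> y) (V0 y) = 0" if "y \<in> M" for y
    using that by (auto simp: \<phi>_V)
  have "form2 (cmat (\<phi> x)) (cov_deriv g (V (s \<rho>) \<rho> x) (V (s \<mu>) \<mu>) x) (V0 x)
      + form2 (cmat (\<phi> x)) (V (s \<mu>) \<mu> x) (cov_deriv g (V (s \<rho>) \<rho> x) V0 x) = 0"
    using cov_deriv_leibniz_zero[OF \<phi>_differentiable[OF x] V_differentiable[OF x]
        V0_differentiable[OF x] open_M x zero, where g = g and X = "V (s \<rho>) \<rho> x"]
      nabla_\<phi>_vanishes[OF x V_in_\<D>[OF x, of s \<mu>] disjI2[OF refl], of \<rho>] by simp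
  then have "\<Lambda> (s \<mu>) \<mu> x * form1 (\<theta> (\<not> s \<mu>) \<mu> x) (cov_deriv g (V (s \<rho>) \<rho> x) V0 x) = 0"
    unfolding \<phi>_skew_form[OF x, of _ "V0 x"] by (simp add: \<phi>_V[OF x] \<phi>_V0[OF x])
  then show ?thesis using \<Lambda>_nonzero[OF x] by simp
qed

lemma \<D>_cov_deriv_orth:
  assumes x: "x \<in> M" and X: "X \<in> \<D> s x" and Y: "Y \<in> \<D> s x"
    and P: "P = V0 \<or> (\<exists>\<nu>. P = V (s \<nu>) \<nu>)"
  shows "form2 (cmat (g x)) Y (cov_deriv g X P x) = 0"
proof -
  have ann: "form1 (\<theta> (\<not> s \<mu>) \<mu> x) (cov_deriv g X P x) = 0" for \<mu>
  proof (rule \<D>_induct[OF x X, where P = "\<lambda>X. form1 (\<theta> (\<not> s \<mu>) \<mu> x) (cov_deriv g X P x) = 0"])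
    show "vec.subspace {X. form1 (\<theta> (\<not> s \<mu>) \<mu> x) (cov_deriv g X P x) = 0}"
      by (rule vec.subspaceI) auto
    show "form1 (\<theta> (\<not> s \<mu>) \<mu> x) (cov_deriv g (V (s \<rho>) \<rho> x) P x) = 0" for \<rho>
      using P \<theta>_cov_deriv_V[OF x] \<theta>_cov_deriv_V0[OF x] by blast
  qed
  show ?thesis
  proof (rule \<D>_induct[OF x Y, where P = "\<lambda>Y. form2 (cmat (g x)) Y (cov_deriv g X P x) = 0"])
    show "vec.subspace {Y. form2 (cmat (g x)) Y (cov_deriv g X P x) = 0}"
      by (rule vec.subspaceI) auto
    show "form2 (cmat (g x)) (V (s \<mu>) \<mu> x) (cov_deriv g X P x) = 0" for \<mu>
      by (simp add: g_V[OF x] ann)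
  qed
qed

text \<open>
  The orthogonal complement is spanned by the fields \<open>P\<close> among \<open>V0\<close> and the \<open>V (s \<nu>) \<nu>\<close>, and \<open>g(\<nabla>\<^sub>X Y, P) = -g(Y, \<nabla>\<^sub>X P)\<close>
  whenever \<open>Y\<close> is a section. The right side depends on the value of \<open>Y\<close> at the point only, so
  the frame computation extends to all sections without differentiating coefficient functions.
\<close>

lemma \<D>_parallel:
  assumes W: "open W" "x \<in> W" "W \<subseteq> M" and Y: "Y differentiable (at x)"
    and Y_in: "\<And>y. y \<in> W \<Longrightarrow> Y y \<in> \<D> s y" and X: "X \<in> \<D> s x"
  shows "cov_deriv g X Y x \<in> \<D> s x"
proof -
  have x: "x \<in> M" using W by auto
  have "form2 (cmat (g x)) (P x) (cov_deriv g X Y x) = 0"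
    if P: "P = V0 \<or> (\<exists>\<nu>. P = V (s \<nu>) \<nu>)" for P
  proof -
    have diff: "P differentiable (at x)" using P V0_differentiable[OF x] V_differentiable[OF x] by blast
    have "form2 (cmat (g y)) (Y y) (P y) = 0" if "y \<in> W" for y
    proof -
      have y: "y \<in> M" using that W by auto
      have "form2 (cmat (g y)) (P y) (Y y) = 0"
        using P Y_in[OF that] by (auto simp: g_V[OF y] g_V0[OF y] mem_\<D>_iff[OF y])
      then show ?thesis using g_sym_form[OF y] by simp
    qed
    then have "form2 (cmat (g x)) (cov_deriv g X Y x) (P x)
        + form2 (cmat (g x)) (Y x) (cov_deriv g X P x) = 0"
      by (rule metric_leibniz_zero[OF x Y diff W(1,2)])
    then show ?thesis
      using \<D>_cov_deriv_orth[OF x X Y_in[OF W(2)] P] g_sym_form[OF x] by simp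
  qed
  note orth = this
  have "form1 (\<theta> (\<not> s \<mu>) \<mu> x) (cov_deriv g X Y x) = 0" for \<mu>
    using orth[of "V (s \<mu>) \<mu>"] c_nonzero[OF x] by (auto simp: g_V[OF x])
  moreover have "form1 (e0 x) (cov_deriv g X Y x) = 0"
    using orth[of V0] by (simp add: g_V0[OF x])
  ultimately show ?thesis using mem_\<D>_iff[OF x] by blast
qed

lemma \<D>_integrable: "integrable_distribution M (\<D> s)"
  unfolding integrable_distribution_def
proof (intro allI impI ballI, elim conjE)
  fix W X Y x
  assume W: "open W" "W \<subseteq> M" and X: "smooth_on W X" and Y: "smooth_on W Y"
    and in_D: "\<forall>x\<in>W. X x \<in> \<D> s x \<and> Y x \<in> \<D> s x" and x: "x \<in> W"
  have xM: "x \<in> M" using x W by auto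
  have "cov_deriv g (X x) Y x \<in> \<D> s x" "cov_deriv g (Y x) X x \<in> \<D> s x"
    by (rule \<D>_parallel[OF W(1) x W(2)]; use in_D X Y x smooth_on_differentiable in blast)+
  then show "lie_bracket X Y x \<in> \<D> s x"
    unfolding lie_bracket_cov_deriv[OF xM] using \<D>_subspace[OF xM] by (rule vec.subspace_diff[rotated])
qed

end


section \<open>Euclidean signature\<close>

lemma index_zero_positive_definite:
  fixes g :: "real^'n::finite \<Rightarrow> real^'n^'n"
  assumes "has_index M g 0" "x \<in> M" "v \<noteq> 0"
  shows "form2 (g x) v v > 0"
proof -
  obtain P :: "real^'n^'n" and \<epsilon> :: "'n \<Rightarrow> real" where P: "invertible P"
    and \<epsilon>: "\<forall>i. \<epsilon> i = 1 \<or> \<epsilon> i = -1" "card {i. \<epsilon> i = -1} = 0"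
    and diag: "transpose P ** g x ** P = (\<chi> i j. if i = j then \<epsilon> i else 0)"
    using assms(1,2) unfolding has_index_def by blast
  have "\<epsilon> i = 1" for i using \<epsilon> by auto
  then have one: "transpose P ** g x ** P = mat 1" unfolding diag by (simp add: mat_def vec_eq_iff)
  obtain Q where "P ** Q = mat 1" using P invertible_def by blast
  then have v: "v = P *v (Q *v v)" by (simp add: matrix_vector_mul_assoc)
  define w where "w = Q *v v"
  have "form2 (g x) v v = (P *v w) \<bullet> (g x *v (P *v w))"
    using v by (simp add: form2_matrix inner_vec_def w_def)
  also have "\<dots> = w \<bullet> (transpose P *v (g x *v (P *v w)))"
    unfolding dot_lmul_matrix[symmetric] by (metis transpose_matrix_vector transpose_transpose)
  also have "\<dots> = w \<bullet> w"
    using one by (simp add: matrix_vector_mul_assoc matrix_mul_assoc)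
  finally show ?thesis using v assms(3) by (auto simp: w_def)
qed

text \<open>
  If \<open>Y\<close> and its conjugate both lie in an isotropic space, then the hermitian norm of \<open>Y\<close> vanishes.
\<close>

lemma (in cky_frame) \<D>_CR_structure:
  assumes "euclidean_signature M g" and card: "CARD('n) = 2 * CARD('m) + 1"
  shows "CR_structure M (\<D> s)"
proof -
  have "\<D> s x \<inter> conj_distribution (\<D> s) x = {0}" if x: "x \<in> M" for x
  proof
    show "{0} \<subseteq> \<D> s x \<inter> conj_distribution (\<D> s) x"
      using vec.subspace_0[OF \<D>_subspace[OF x]] by (auto simp: conj_distribution_def image_iff
        intro!: bexI[of _ 0])
    show "\<D> s x \<inter> conj_distribution (\<D> s) x \<subseteq> {0}"
    proof
      fix X assume "X \<in> \<D> s x \<inter> conj_distribution (\<D> s) x"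
      then obtain Y where Y: "Y \<in> \<D> s x" "X = cnj_vec Y" "cnj_vec Y \<in> \<D> s x"
        by (auto simp: conj_distribution_def)
      have "Y = 0"
        by (rule form2_hermitian_definite[OF g_sym[OF x] _ \<D>_isotropic[OF x Y(1,3)]])
          (use index_zero_positive_definite[OF _ x] assms(1) in \<open>auto simp: euclidean_signature_def\<close>)
      then show "X \<in> {0}" using Y(2) by simp
    qed
  qed
  then show ?thesis
    using card \<D>_smooth \<D>_integrable by (auto simp: CR_structure_def almost_CR_structure_def)
qed


section \<open>Lorentzian signature\<close>

locale lorentz_frame = cky_frame M g \<phi> lam c e0 V0 \<theta>u \<theta>l Vl Vu
  for M :: "(real^'n::finite) set" and g \<phi> :: "real^'n \<Rightarrow> real^'n^'n"
    and lam :: "'m::finite \<Rightarrow> real^'n \<Rightarrow> complex"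
    and c :: real
    and e0 V0 :: "real^'n \<Rightarrow> complex^'n"
    and \<theta>u \<theta>l Vl Vu :: "'m \<Rightarrow> real^'n \<Rightarrow> complex^'n" +
  fixes \<mu>1 :: 'm
  assumes lorentz: "lorentzian_coframe M lam \<theta>u \<theta>l \<mu>1"
begin

lemma cnj_\<theta>: "x \<in> M \<Longrightarrow> cnj_vec (\<theta> b \<mu> x) = \<theta> (if \<mu> = \<mu>1 then b else \<not> b) \<mu> x"
  using lorentz unfolding lorentzian_coframe_def \<theta>_def by auto

lemma \<theta>_cnj:
  assumes "x \<in> M"
  shows "form1 (\<theta> b \<mu> x) (cnj_vec X) = cnj (form1 (\<theta> (if \<mu> = \<mu>1 then b else \<not> b) \<mu> x) X)"
  unfolding cnj_\<theta>[OF assms, of b \<mu>, symmetric] form1_cnj[symmetric] by simp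

text \<open>The kernel of \<open>e0\<close> is invariant under conjugation, whether or not \<open>e0\<close> is real: it is the
  \<open>g\<close>-orthogonal complement of the kernel of the real form \<open>\<phi>\<close>.\<close>

lemma e0_cnj:
  assumes x: "x \<in> M" and X: "form1 (e0 x) X = 0"
  shows "form1 (e0 x) (cnj_vec X) = 0"
proof -
  have "form2 (cmat (\<phi> x)) (cnj_vec (V0 x)) Y = 0" for Y
    using form2_cnj[of "\<phi> x" "V0 x" "cnj_vec Y"] \<phi>_V0[OF x] by simp
  then have "cnj_vec (V0 x) \<in> vec.span {V0 x}"
    using kernel_eq[OF x] by (auto simp: form2_kernel_def)
  then obtain k where k: "cnj_vec (V0 x) = k *s V0 x" by (auto simp: vec.span_singleton)
  have "form1 (e0 x) (cnj_vec X) = form2 (cmat (g x)) (V0 x) (cnj_vec X)" by (simp add: g_V0[OF x])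
  also have "\<dots> = cnj (form2 (cmat (g x)) (cnj_vec (V0 x)) X)"
    using form2_cnj[of "g x" "cnj_vec (V0 x)" X] by simp
  also have "\<dots> = 0" by (simp add: k g_V0[OF x] X)
  finally show ?thesis .
qed

lemma cnj_V1: "x \<in> M \<Longrightarrow> cnj_vec (V b \<mu>1 x) = V b \<mu>1 x"
  by (rule coframe_eqI) (auto simp: \<theta>_cnj e0_cnj)

definition R :: "bool \<Rightarrow> real^'n \<Rightarrow> real^'n" where
  "R b x = (\<chi> i. Re (V b \<mu>1 x $ i))"

lemma cvec_R: "x \<in> M \<Longrightarrow> cvec (R b x) = V b \<mu>1 x"
  unfolding R_def by (rule real_vector_is_cvec[OF cnj_V1])

lemma V_nonzero:
  assumes x: "x \<in> M"
  shows "V b \<mu> x \<noteq> 0"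
proof
  assume "V b \<mu> x = 0"
  then have "form1 (\<theta> b \<mu> x) (V b \<mu> x) = 0" by (simp only: form1_simps)
  then show False by (simp add: x)
qed

lemma R_nonzero: "x \<in> M \<Longrightarrow> R b x \<noteq> 0"
  using cvec_R[of x b] V_nonzero[of x b \<mu>1] by auto

lemma smooth_R: "smooth_on M (R b)"
proof -
  have "bounded_linear (\<lambda>X :: complex^'n. \<chi> i. Re (X $ i))"
    by (rule linear_conv_bounded_linear[THEN iffD1]) (auto intro!: linearI simp: vec_eq_iff)
  from smooth_on_linear[OF this open_M smooth_V] show ?thesis unfolding R_def .
qed

lemma \<D>_inter_conj:
  assumes x: "x \<in> M"
  shows "\<D> s x \<inter> conj_distribution (\<D> s) x = vec.span {V (s \<mu>1) \<mu>1 x}"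
proof (intro equalityI subsetI)
  fix X assume "X \<in> \<D> s x \<inter> conj_distribution (\<D> s) x"
  then have X: "X \<in> \<D> s x" and cX: "cnj_vec X \<in> \<D> s x" by (auto simp: conj_distribution_def)
  have "form1 (\<theta> b \<mu> x) X = 0" if "b = (\<not> s \<mu>) \<or> \<mu> \<noteq> \<mu>1" for b \<mu>
  proof (cases "b = (\<not> s \<mu>)")
    case True
    then show ?thesis using X mem_\<D>_iff[OF x] by simp
  next
    case False
    have "form1 (\<theta> (\<not> s \<mu>) \<mu> x) (cnj_vec X) = 0" using cX mem_\<D>_iff[OF x] by blast
    then show ?thesis using \<theta>_cnj[OF x, of "\<not> s \<mu>" \<mu> X] False that by auto
  qed
  note ann = this
  have "X = form1 (\<theta> (s \<mu>1) \<mu>1 x) X *s V (s \<mu>1) \<mu>1 x"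
  proof (rule coframe_eqI[OF x])
    show "form1 (e0 x) X = form1 (e0 x) (form1 (\<theta> (s \<mu>1) \<mu>1 x) X *s V (s \<mu>1) \<mu>1 x)"
      using X mem_\<D>_iff[OF x] x by simp
    show "form1 (\<theta> b \<mu> x) X = form1 (\<theta> b \<mu> x) (form1 (\<theta> (s \<mu>1) \<mu>1 x) X *s V (s \<mu>1) \<mu>1 x)" for b \<mu>
      using ann[of b \<mu>] x by auto
  qed
  then show "X \<in> vec.span {V (s \<mu>1) \<mu>1 x}" by (metis vec.span_base vec.span_scale singletonI)
next
  fix X assume "X \<in> vec.span {V (s \<mu>1) \<mu>1 x}"
  then obtain k where k: "X = k *s V (s \<mu>1) \<mu>1 x" by (auto simp: vec.span_singleton)
  have D: "a *s V (s \<mu>1) \<mu>1 x \<in> \<D> s x" for a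
    by (rule vec.subspace_scale[OF \<D>_subspace[OF x] V_in_\<D>[OF x]])
  have "X = cnj_vec (cnj k *s V (s \<mu>1) \<mu>1 x)" by (simp add: k cnj_V1[OF x])
  then have "X \<in> conj_distribution (\<D> s) x"
    unfolding conj_distribution_def using D[of "cnj k"] by (rule image_eqI)
  then show "X \<in> \<D> s x \<inter> conj_distribution (\<D> s) x" using D[of k] k by simp
qed

lemma real_line_field_\<D>:
  assumes x: "x \<in> M"
  shows "real_line_field (\<D> s) x = span {R (s \<mu>1) x}"
proof (intro equalityI subsetI)
  fix v assume "v \<in> real_line_field (\<D> s) x"
  then obtain k where k: "cvec v = k *s cvec (R (s \<mu>1) x)"
    by (auto simp: real_line_field_def \<D>_inter_conj[OF x] cvec_R[OF x] vec.span_singleton)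
  obtain i where i: "R (s \<mu>1) x $ i \<noteq> 0" using R_nonzero[OF x] by (metis vec_eq_iff zero_index)
  have "complex_of_real (v $ i) = k * complex_of_real (R (s \<mu>1) x $ i)"
    using arg_cong[OF k, of "\<lambda>X. X $ i"] by (simp add: cvec_def)
  then have "k = complex_of_real (v $ i / R (s \<mu>1) x $ i)"
    using i by (simp add: field_simps)
  then have "cvec v = cvec ((v $ i / R (s \<mu>1) x $ i) *\<^sub>R R (s \<mu>1) x)" using k by simp
  then show "v \<in> span {R (s \<mu>1) x}"
    using cvec_inj by (metis span_base span_scale singletonI)
next
  fix v assume "v \<in> span {R (s \<mu>1) x}"
  then obtain r where "v = r *\<^sub>R R (s \<mu>1) x" by (auto simp: span_singleton)
  then show "v \<in> real_line_field (\<D> s) x"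
    by (auto simp: real_line_field_def \<D>_inter_conj[OF x] cvec_R[OF x] vec.span_singleton)
qed

lemma \<D>_null_line_field: "null_line_field M g (real_line_field (\<D> s))"
  unfolding null_line_field_def
proof (intro ballI conjI)
  fix x assume x: "x \<in> M"
  show "subspace (real_line_field (\<D> s) x)" by (simp add: real_line_field_\<D>[OF x])
  show "dim (real_line_field (\<D> s) x) = 1"
    using R_nonzero[OF x] by (simp add: real_line_field_\<D>[OF x] dim_singleton)
  fix v assume "v \<in> real_line_field (\<D> s) x"
  then have "cvec v \<in> \<D> s x" by (simp add: real_line_field_def)
  from \<D>_isotropic[OF x this this] show "form2 (g x) v v = 0" by (simp add: form2_cvec)
qed

lemma \<D>_inter_conj_real:
  assumes x: "x \<in> M"
  shows "\<D> s x \<inter> conj_distribution (\<D> s) x = vec.span (cvec ` real_line_field (\<D> s) x)"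
proof (rule antisym)
  have "R (s \<mu>1) x \<in> real_line_field (\<D> s) x" by (simp add: real_line_field_\<D>[OF x] span_base)
  then have "{V (s \<mu>1) \<mu>1 x} \<subseteq> cvec ` real_line_field (\<D> s) x"
    using cvec_R[OF x, of "s \<mu>1", symmetric] by simp
  then show "\<D> s x \<inter> conj_distribution (\<D> s) x \<subseteq> vec.span (cvec ` real_line_field (\<D> s) x)"
    unfolding \<D>_inter_conj[OF x] by (rule vec.span_mono)
  show "vec.span (cvec ` real_line_field (\<D> s) x) \<subseteq> \<D> s x \<inter> conj_distribution (\<D> s) x"
    by (rule vec.span_minimal) (auto simp: real_line_field_def \<D>_inter_conj[OF x])
qed

definition curves :: "bool \<Rightarrow> (real set \<times> (real \<Rightarrow> real^'n)) set" where
  "curves b = integral_curves M (\<lambda>x. span {R b x})"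

lemma integral_curves_\<D>: "integral_curves M (real_line_field (\<D> s)) = curves (s \<mu>1)"
  unfolding curves_def integral_curves_def
  using real_line_field_\<D>[of _ s] by (intro Collect_cong) auto

lemma curve_through:
  assumes x: "x \<in> M"
  obtains J \<gamma> where "(J, \<gamma>) \<in> curves b" "0 \<in> J" "\<gamma> 0 = x" "vector_derivative \<gamma> (at 0) = R b x"
proof -
  obtain a \<gamma> where a: "a > 0" "\<gamma> 0 = x" "smooth_on {-a<..<a} \<gamma>"
    and \<gamma>: "\<And>t. t \<in> {-a<..<a} \<Longrightarrow> \<gamma> t \<in> M \<and> (\<gamma> has_vector_derivative R b (\<gamma> t)) (at t)"
    using integral_curve_exists[OF open_M smooth_R x] by blast
  have vd: "vector_derivative \<gamma> (at t) = R b (\<gamma> t)" if "t \<in> {-a<..<a}" for t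
    using \<gamma>[OF that] by (auto intro: vector_derivative_at)
  have "({-a<..<a}, \<gamma>) \<in> curves b"
    unfolding curves_def integral_curves_def
    using a \<gamma> R_nonzero by (auto simp: vd span_base is_interval_oo)
  then show thesis using that[of "{-a<..<a}" \<gamma>] a vd[of 0] by simp
qed

text \<open>
  The sets of curves could agree only if they were empty, since a common curve would be tangent to both
  line fields.
\<close>

lemma curves_distinct:
  assumes "M \<noteq> {}"
  shows "curves True \<noteq> curves False"
proof
  assume eq: "curves True = curves False"
  obtain x where x: "x \<in> M" using assms by blast
  obtain J \<gamma> where J: "(J, \<gamma>) \<in> curves True" "0 \<in> J" "\<gamma> 0 = x" "vector_derivative \<gamma> (at 0) = R True x"
    using curve_through[OF x] by blast
  then have "R True x \<in> span {R False x}"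
    unfolding eq unfolding curves_def integral_curves_def by force
  then obtain r where "R True x = r *\<^sub>R R False x" by (auto simp: span_singleton)
  then have V_eq: "V True \<mu>1 x = complex_of_real r *s V False \<mu>1 x"
    using cvec_R[OF x] cvec_simps(2) by metis
  have "form1 (\<theta> True \<mu>1 x) (V True \<mu>1 x) = 0" unfolding V_eq using x by simp
  then show False using x by simp
qed


subsection \<open>The congruences are geodesic\<close>

text \<open>
  The velocity is \<open>h V\<close> for a real function \<open>h\<close>, so the acceleration is
  \<open>h' V + h\<^sup>2 \<nabla>\<^sub>V V\<close>. It lies in the distribution because the distribution is parallel along itself,
  and it is real.
\<close>

lemma acceleration_tangent:
  assumes C: "(J, \<gamma>) \<in> curves b" and t: "t \<in> J"
  shows "acceleration g \<gamma> t \<in> span {R b (\<gamma> t)}"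
proof -
  define v where "v t = vector_derivative \<gamma> (at t)" for t
  have J: "open J" "smooth_on J \<gamma>" and M: "\<And>t. t \<in> J \<Longrightarrow> \<gamma> t \<in> M"
    and tangent: "\<And>t. t \<in> J \<Longrightarrow> v t \<in> span {R b (\<gamma> t)}"
    using C unfolding curves_def integral_curves_def v_def by auto
  have xM: "\<gamma> t \<in> M" using M t by blast
  have \<gamma>': "(\<gamma> has_vector_derivative v t) (at t)"
    unfolding v_def vector_derivative_works[symmetric] using smooth_on_differentiable[OF J(2) t] .
  have v_diff: "v differentiable (at t)"
  proof -
    have "ck_on (Suc (Suc 0)) J \<gamma>" using J(2) by (simp add: smooth_on_def del: ck_on.simps)
    then have "(\<lambda>t. frechet_derivative \<gamma> (at t) 1) differentiable (at t)" using t by simp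
    moreover have "v s = frechet_derivative \<gamma> (at s) 1" if "s \<in> J" for s
      unfolding v_def
      using smooth_on_has_derivative[OF J(2) that] frechet_derivative_at
        vector_derivative_works[THEN iffD1, OF smooth_on_differentiable[OF J(2) that]]
      unfolding has_vector_derivative_def by (metis scaleR_one)
    ultimately show ?thesis
      using J(1) t unfolding differentiable_def
      by (metis (no_types, lifting) has_derivative_transform_within_open)
  qed
  \<comment> \<open>expressing \<open>h\<close> by the dual covector makes it visibly differentiable\<close>
  define h where "h s = Re (form1 (\<theta> b \<mu>1 (\<gamma> s)) (cvec (v s)))" for s
  have h: "v s = h s *\<^sub>R R b (\<gamma> s)" if s: "s \<in> J" for s
  proof -
    obtain r where "v s = r *\<^sub>R R b (\<gamma> s)" using tangent[OF s] by (auto simp: span_singleton)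
    moreover from this have "h s = r" unfolding h_def by (simp add: cvec_R M[OF s])
    ultimately show ?thesis by simp
  qed
  have "h differentiable (at t)"
  proof -
    obtain \<Theta>' where \<Theta>': "((\<lambda>s. \<theta> b \<mu>1 (\<gamma> s)) has_derivative \<Theta>') (at t)"
      using has_derivative_compose[OF \<gamma>'[unfolded has_vector_derivative_def]]
        \<theta>_differentiable[OF xM] unfolding differentiable_def by blast
    obtain v' where v': "(v has_derivative v') (at t)" using v_diff unfolding differentiable_def by blast
    have "h = (\<lambda>s. Re (\<Sum>i\<in>UNIV. \<theta> b \<mu>1 (\<gamma> s) $ i * complex_of_real (v s $ i)))"
      by (simp add: h_def form1_def cvec_def fun_eq_iff)
    moreover have "((\<lambda>s. Re (\<Sum>i\<in>UNIV. \<theta> b \<mu>1 (\<gamma> s) $ i * complex_of_real (v s $ i))) has_derivative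
        (\<lambda>u. Re (\<Sum>i\<in>UNIV. \<theta> b \<mu>1 (\<gamma> t) $ i * complex_of_real (v' u $ i)
          + \<Theta>' u $ i * complex_of_real (v t $ i)))) (at t)"
      by (intro bounded_linear.has_derivative[OF bounded_linear_Re] has_derivative_sum
          has_derivative_mult has_derivative_of_real has_derivative_nth \<Theta>' v')
    ultimately show ?thesis unfolding differentiable_def by blast
  qed
  then obtain h' where h': "(h has_vector_derivative h') (at t)"
    using vector_derivative_works by blast
  let ?V = "V b \<mu>1" and ?x = "\<gamma> t"
  obtain v' where v': "(v has_vector_derivative v') (at t)"
    using v_diff vector_derivative_works by blast
  have bl: "bounded_linear (cvec :: real^'n \<Rightarrow> complex^'n)"
    by (rule linear_conv_bounded_linear[THEN iffD1])
      (auto intro!: linearI simp: of_real_smult)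
  have V': "((\<lambda>s. ?V (\<gamma> s)) has_vector_derivative frechet_derivative ?V (at ?x) (v t)) (at t)"
  proof -
    have d: "(?V has_derivative frechet_derivative ?V (at ?x)) (at ?x)"
      using V_differentiable[OF xM] frechet_derivative_works by blast
    have "frechet_derivative ?V (at ?x) (u *\<^sub>R v t) = u *\<^sub>R frechet_derivative ?V (at ?x) (v t)" for u
      by (rule linear_scale[OF has_derivative_linear[OF d]])
    with has_derivative_compose[OF \<gamma>'[unfolded has_vector_derivative_def] d] show ?thesis
      unfolding has_vector_derivative_def by simp
  qed
  have "((\<lambda>s. h s *\<^sub>R ?V (\<gamma> s)) has_vector_derivative
      (h t *\<^sub>R frechet_derivative ?V (at ?x) (v t) + h' *\<^sub>R ?V ?x)) (at t)"
    using has_vector_derivative_scaleR[OF h'[folded has_real_derivative_iff_has_vector_derivative] V'] .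
  then have "((\<lambda>s. cvec (v s)) has_vector_derivative
      (h t *\<^sub>R frechet_derivative ?V (at ?x) (v t) + h' *\<^sub>R ?V ?x)) (at t)"
  proof (rule has_vector_derivative_transform_within_open[OF _ J(1) t])
    fix s assume s: "s \<in> J"
    show "h s *\<^sub>R ?V (\<gamma> s) = cvec (v s)"
      unfolding h[OF s] cvec_simps cvec_R[OF M[OF s]] by (simp add: of_real_smult)
  qed
  moreover have "((\<lambda>s. cvec (v s)) has_vector_derivative cvec v') (at t)"
    by (rule bounded_linear.has_vector_derivative[OF bl v'])
  ultimately have v'_eq: "cvec v' = h t *\<^sub>R frechet_derivative ?V (at ?x) (v t) + h' *\<^sub>R ?V ?x"
    using vector_derivative_unique_at by blast
  have acc: "cvec (acceleration g \<gamma> t) = cvec v' + conn_term g ?x (cvec (v t)) (cvec (v t))"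
  proof -
    have "acceleration g \<gamma> t = v' + (\<chi> k. \<Sum>i\<in>UNIV. \<Sum>j\<in>UNIV. christoffel g ?x k i j * v t $ i * v t $ j)"
      using vector_derivative_at[OF v'] unfolding acceleration_def v_def by simp
    then show ?thesis by (simp add: conn_term_def cvec_def vec_eq_iff)
  qed
  have vt: "cvec (v t) = complex_of_real (h t) *s ?V ?x"
    unfolding h[OF t] by (simp add: cvec_R[OF xM])
  have "cvec (acceleration g \<gamma> t) =
      complex_of_real (h t) *s cov_deriv g (cvec (v t)) ?V ?x + complex_of_real h' *s ?V ?x"
  proof -
    have "conn_term g ?x (cvec (v t)) (cvec (v t)) = complex_of_real (h t) *s conn_term g ?x (cvec (v t)) (?V ?x)"
      unfolding vt by (simp add: conn_term_def vec_eq_iff sum_distrib_left mult_ac)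
    then show ?thesis
      unfolding acc v'_eq cov_deriv_def dir_deriv_cvec[OF V_differentiable[OF xM]]
      by (simp add: of_real_smult scaleR_add_right)
  qed
  also have "\<dots> = (complex_of_real (h t) * complex_of_real (h t)) *s cov_deriv g (?V ?x) ?V ?x
      + complex_of_real h' *s ?V ?x"
    unfolding vt by simp
  also have "\<dots> \<in> \<D> (\<lambda>_. b) ?x"
  proof -
    have V_in: "?V y \<in> \<D> (\<lambda>_. b) y" if "y \<in> M" for y using V_in_\<D>[OF that, of "\<lambda>_. b"] .
    have "cov_deriv g (?V ?x) ?V ?x \<in> \<D> (\<lambda>_. b) ?x"
      by (rule \<D>_parallel[OF open_M xM subset_refl V_differentiable[OF xM] V_in V_in[OF xM]])
    then show ?thesis
      using V_in[OF xM] \<D>_subspace[OF xM] by (intro vec.subspace_add vec.subspace_scale)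
  qed
  finally have "acceleration g \<gamma> t \<in> real_line_field (\<D> (\<lambda>_. b)) ?x"
    unfolding real_line_field_def conj_distribution_def by (force simp: image_iff intro: bexI)
  then show ?thesis by (simp add: real_line_field_\<D>[OF xM])
qed

lemma curves_geodesic_congruence: "geodesic_congruence M g (curves b)"
  unfolding geodesic_congruence_def
proof (intro conjI ballI)
  fix x assume "x \<in> M"
  then obtain J \<gamma> where "(J, \<gamma>) \<in> curves b" "0 \<in> J" "\<gamma> 0 = x" using curve_through by blast
  then show "\<exists>(J, \<gamma>)\<in>curves b. x \<in> \<gamma> ` J" by (intro bexI[of _ "(J, \<gamma>)"]) auto
next
  fix p assume "p \<in> curves b"
  then obtain J \<gamma> where p: "p = (J, \<gamma>)" and C: "(J, \<gamma>) \<in> curves b" by (cases p) auto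
  have ex: "\<exists>f. acceleration g \<gamma> t = f *\<^sub>R vector_derivative \<gamma> (at t)" if t: "t \<in> J" for t
  proof -
    have "vector_derivative \<gamma> (at t) \<noteq> 0" "vector_derivative \<gamma> (at t) \<in> span {R b (\<gamma> t)}"
      using C t unfolding curves_def integral_curves_def by auto
    then obtain r where r: "r \<noteq> 0" "vector_derivative \<gamma> (at t) = r *\<^sub>R R b (\<gamma> t)"
      by (auto simp: span_singleton)
    obtain k where k: "acceleration g \<gamma> t = k *\<^sub>R R b (\<gamma> t)"
      using acceleration_tangent[OF C t] by (auto simp: span_singleton)
    show ?thesis by (rule exI[of _ "k / r"]) (simp add: r k)
  qed
  have "geodesic_on g J \<gamma>"
    unfolding geodesic_on_def
    by (rule exI[of _ "\<lambda>t. SOME f. acceleration g \<gamma> t = f *\<^sub>R vector_derivative \<gamma> (at t)"])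
      (use ex in \<open>auto intro: someI_ex\<close>)
  then show "case p of (J, \<gamma>) \<Rightarrow> geodesic_on g J \<gamma>" by (simp add: p)
qed

end


section \<open>Counting the distributions\<close>

lemma card_bool_fun: "CARD('m::finite \<Rightarrow> bool) = 2 ^ CARD('m)"
  by (simp add: card_fun)

text \<open>Flipping the choice at \<open>\<mu>\<close> exchanges the two halves.\<close>

lemma card_bool_fun_fixed: "card {s :: 'm::finite \<Rightarrow> bool. s \<mu> = b} = 2 ^ (CARD('m) - 1)"
proof -
  let ?S = "\<lambda>b. {s :: 'm \<Rightarrow> bool. s \<mu> = b}"
  have "bij_betw (\<lambda>s. s(\<mu> := \<not> s \<mu>)) (?S b) (?S (\<not> b))"
    by (rule bij_betw_byWitness[where f' = "\<lambda>s. s(\<mu> := \<not> s \<mu>)"]) (auto simp: fun_upd_idem_iff)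
  then have "card (?S b) = card (?S (\<not> b))" by (rule bij_betw_same_card)
  moreover have "CARD('m \<Rightarrow> bool) = card (?S b) + card (?S (\<not> b))"
    by (subst card_Un_disjoint[symmetric]) (auto intro!: arg_cong[of _ _ card])
  ultimately have "2 * card (?S b) = 2 ^ CARD('m)" using card_bool_fun[where 'm = 'm] by simp
  moreover have "(2::nat) ^ CARD('m) = 2 * 2 ^ (CARD('m) - 1)"
    by (simp add: power_Suc[symmetric] del: power_Suc)
  ultimately show ?thesis by simp
qed

theorem mainTheorem2:
  fixes M :: "(real^'n::finite) set"
    and g \<phi> :: "real^'n \<Rightarrow> real^'n^'n"
    and lam :: "'m::finite \<Rightarrow> real^'n \<Rightarrow> complex"
    and c :: real
    and e0 V0 :: "real^'n \<Rightarrow> complex^'n"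
    and \<theta>u \<theta>l Vl Vu :: "'m \<Rightarrow> real^'n \<Rightarrow> complex^'n"
  assumes "open M" and "M \<noteq> {}"
    and "CARD('n) = 2 * CARD('m) + 1"
    and "pseudo_riemannian_metric M g"
    and "conformal_killing_yano M g \<phi>"
    and "\<forall>x\<in>M. vec.dim (form2_kernel \<phi> x) = 1"
    and "distinct_eigenvalues M g \<phi> lam"
    and "adapted_coframe M g \<phi> lam c e0 \<theta>u \<theta>l"
    and "dual_frame M e0 \<theta>u \<theta>l V0 Vl Vu"
    and "\<forall>x\<in>M. \<forall>\<mu>. \<forall>X Y Z.
           wedge12 (form1 (\<theta>u \<mu> x)) (form3 (cten (ext_deriv2 \<phi> x)) (Vu \<mu> x)) X Y Z = 0 \<and>
           wedge12 (form1 (\<theta>l \<mu> x)) (form3 (cten (ext_deriv2 \<phi> x)) (Vl \<mu> x)) X Y Z = 0"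
  shows "(\<forall>x\<in>M. form2_kernel \<phi> x = vec.span {V0 x}) \<and>
    card (frame_distributions M Vl Vu) = 2 ^ CARD('m) \<and>
    (\<forall>D\<in>frame_distributions M Vl Vu.
       smooth_distribution M CARD('m) D \<and>
       isotropic_distribution M g D \<and>
       (\<forall>x\<in>M. D x \<subseteq> orth_complement g (form2_kernel \<phi>) x) \<and>
       integrable_distribution M D) \<and>
    (euclidean_signature M g \<longrightarrow>
       (\<forall>D\<in>frame_distributions M Vl Vu. CR_structure M D)) \<and>
    (\<forall>\<mu>1. lorentzian_signature M g \<and> lorentzian_coframe M lam \<theta>u \<theta>l \<mu>1 \<longrightarrow>
       (\<forall>D\<in>frame_distributions M Vl Vu.
          null_line_field M g (real_line_field D) \<and>
          (\<forall>x\<in>M. D x \<inter> conj_distribution D x = vec.span (cvec ` real_line_field D x))) \<and>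
       card ((\<lambda>D. integral_curves M (real_line_field D)) ` frame_distributions M Vl Vu) = 2 \<and>
       (\<forall>C\<in>(\<lambda>D. integral_curves M (real_line_field D)) ` frame_distributions M Vl Vu.
          geodesic_congruence M g C \<and>
          card {D \<in> frame_distributions M Vl Vu. integral_curves M (real_line_field D) = C}
            = 2 ^ (CARD('m) - 1)))"
proof -
  interpret cky_frame M g \<phi> lam c e0 V0 \<theta>u \<theta>l Vl Vu
    using assms by unfold_locales auto
  note inj = inj_\<D>[OF \<open>M \<noteq> {}\<close>]
  have card_range: "card (range \<D>) = 2 ^ CARD('m)"
    using card_image[OF inj] card_bool_fun[where 'm = 'm] by simp
  have lorentzian: "(\<forall>D\<in>range \<D>.
          null_line_field M g (real_line_field D) \<and>
          (\<forall>x\<in>M. D x \<inter> conj_distribution D x = vec.span (cvec ` real_line_field D x))) \<and>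
       card ((\<lambda>D. integral_curves M (real_line_field D)) ` range \<D>) = 2 \<and>
       (\<forall>C\<in>(\<lambda>D. integral_curves M (real_line_field D)) ` range \<D>.
          geodesic_congruence M g C \<and>
          card {D \<in> range \<D>. integral_curves M (real_line_field D) = C} = 2 ^ (CARD('m) - 1))"
    if "lorentzian_coframe M lam \<theta>u \<theta>l \<mu>1" for \<mu>1
  proof -
    interpret lorentz_frame M g \<phi> lam c e0 V0 \<theta>u \<theta>l Vl Vu \<mu>1
      using that by unfold_locales
    have curves_inj: "curves a = curves b \<longleftrightarrow> a = b" for a b
      using curves_distinct[OF \<open>M \<noteq> {}\<close>] by (cases a; cases b) auto
    have surj: "range (\<lambda>s :: 'm \<Rightarrow> bool. s \<mu>1) = UNIV"
      by (rule surjI[where f = "\<lambda>b _. b"]) simp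
    have image: "(\<lambda>D. integral_curves M (real_line_field D)) ` range \<D> = range curves"
      unfolding image_image integral_curves_\<D> surj[symmetric] by (simp add: image_image)
    have "card (range curves) = 2"
      using card_image[of curves UNIV] curves_inj by (simp add: inj_on_def)
    moreover have "card {D \<in> range \<D>. integral_curves M (real_line_field D) = curves b} = 2 ^ (CARD('m) - 1)"
      for b
    proof -
      have "{D \<in> range \<D>. integral_curves M (real_line_field D) = curves b} = \<D> ` {s. s \<mu>1 = b}"
        by (auto simp: integral_curves_\<D> curves_inj)
      also have "card \<dots> = card {s :: 'm \<Rightarrow> bool. s \<mu>1 = b}"
        by (rule card_image) (rule inj_on_subset[OF inj], simp)
      finally show ?thesis by (simp add: card_bool_fun_fixed)
    qed
    ultimately show ?thesis
      unfolding image
      using \<D>_null_line_field \<D>_inter_conj_real curves_geodesic_congruence by auto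
  qed
  have distributions: "\<forall>D\<in>range \<D>. smooth_distribution M CARD('m) D \<and> isotropic_distribution M g D \<and>
      (\<forall>x\<in>M. D x \<subseteq> orth_complement g (form2_kernel \<phi>) x) \<and> integrable_distribution M D"
  proof
    fix D assume "D \<in> range \<D>"
    then obtain s where D: "D = \<D> s" by blast
    have "isotropic_distribution M g (\<D> s)"
      unfolding isotropic_distribution_def using \<D>_isotropic by blast
    then show "smooth_distribution M CARD('m) D \<and> isotropic_distribution M g D \<and>
      (\<forall>x\<in>M. D x \<subseteq> orth_complement g (form2_kernel \<phi>) x) \<and> integrable_distribution M D"
      unfolding D using \<D>_smooth \<D>_orth_kernel \<D>_integrable by blast
  qed
  have kernel: "\<forall>x\<in>M. form2_kernel \<phi> x = vec.span {V0 x}"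
    using kernel_eq by blast
  have euclidean: "euclidean_signature M g \<longrightarrow> (\<forall>D\<in>range \<D>. CR_structure M D)"
    using \<D>_CR_structure[OF _ assms(3)] by blast
  show ?thesis
    unfolding frame_distributions_eq
    by (rule conjI[OF kernel conjI[OF card_range conjI[OF distributions conjI[OF euclidean]]]],
        intro allI impI, rule lorentzian, elim conjE)
qed

end
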